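(* Let $X$ be an infinite-dimensional real Banach space, and let $\mathcal{P}$ be the set of all strongly measurable Pettis integrable functions from $[0,1]$ into $X$. There exists a set $\mathcal{V}\subset\mathcal{P}$ such that: (1) $\mathcal{V}$ has the cardinality of the continuum; (2) $\mathcal{V}$ is linearly independent; (3) for each sequence $\{\lambda_k\}_{k\ge 1}\in\ell_1$ and each sequence $\{f_k\}_{k\ge1}$ in $\mathcal{V}$, the function $f=\sum_{k=1}^{\infty}\lambda_k f_k$ is in $\mathcal{P}$; and (4) moreover, if such an $f$ is not the zero function, then the primitive $F$ of $f$ has the property that for all $x\in[0,1]$, $$\limsup_{h\to 0}\left\|\frac{F(x+h)-F(x)}{h}\right\|=\infty .$$
   Context: $[0,1]$ carries Lebesgue measure $\lambda$. A function $f:[0,1]\to X$ is Pettis integrable if $x^*f\in L_1[0,1]$ for every $x^*\in X^*$ and for every Lebesgue measurable $E\subseteq[0,1]$ there is a vector $x_E\in X$ with $x^*(x_E)=\int_E x^*f\,d\lambda$ for all $x^*\in X^*$; one writes $x_E=\int_E f$ (the Pettis integral of $f$ over $E$). The primitive of a Pettis integrable $f$ is $F(t)=\int_0^t f$, $t\in[0,1]$. Strongly measurable means an almost everywhere limit of simple measurable functions. The sum $\sum_k\lambda_kf_k$ is the pointwise sum (its convergence at each point of $[0,1]$ is part of assertion (3)). In (4), $h$ ranges over nonzero reals with $x+h\in[0,1]$. *)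

theory Defs
  imports "HOL-Analysis.Analysis" "HOL-Library.Equipollence" "HOL-Library.Function_Algebras"
begin

text \<open>
  A function from \<open>[0,1]\<close> to a space is represented by its extension by zero to the whole
  real line. This identifies the real vector space of all functions on \<open>[0,1]\<close> with a linear
  subspace of the function type; see \<open>pettis_functions\<close>.
\<close>

global_interpretation fun_space: vector_space
  "\<lambda>(c::real) (f :: real \<Rightarrow> 'a::real_vector) x. c *\<^sub>R f x"
  by unfold_locales (auto simp: fun_eq_iff algebra_simps)

definition strongly_measurable :: "(real \<Rightarrow> 'a::real_normed_vector) \<Rightarrow> bool" where
  "strongly_measurable f \<longleftrightarrow>
     (\<exists>s :: nat \<Rightarrow> real \<Rightarrow> 'a.
        (\<forall>n. simple_function (lebesgue_on {0..1}) (s n)) \<and>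
        (AE t in lebesgue_on {0..1}. (\<lambda>n. s n t) \<longlonglongrightarrow> f t))"

definition has_pettis_integral ::
    "(real \<Rightarrow> 'a::real_normed_vector) \<Rightarrow> 'a \<Rightarrow> real set \<Rightarrow> bool" where
  "has_pettis_integral f v E \<longleftrightarrow>
     (\<forall>\<phi> :: 'a \<Rightarrow>\<^sub>L real. blinfun_apply \<phi> v = (LINT t:E|lebesgue. blinfun_apply \<phi> (f t)))"

definition pettis_integrable :: "(real \<Rightarrow> 'a::real_normed_vector) \<Rightarrow> bool" where
  "pettis_integrable f \<longleftrightarrow>
     (\<forall>\<phi> :: 'a \<Rightarrow>\<^sub>L real. integrable (lebesgue_on {0..1}) (\<lambda>t. blinfun_apply \<phi> (f t))) \<and>
     (\<forall>E. E \<in> sets lebesgue \<and> E \<subseteq> {0..1} \<longrightarrow> (\<exists>v. has_pettis_integral f v E))"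

text \<open>The chosen vector is unique, since by Hahn--Banach the dual separates points.\<close>

definition pettis_integral :: "real set \<Rightarrow> (real \<Rightarrow> 'a::real_normed_vector) \<Rightarrow> 'a" where
  "pettis_integral E f = (SOME v. has_pettis_integral f v E)"

definition pettis_primitive :: "(real \<Rightarrow> 'a::real_normed_vector) \<Rightarrow> real \<Rightarrow> 'a" where
  "pettis_primitive f t = pettis_integral {0..t} f"

definition pettis_functions :: "(real \<Rightarrow> 'a::real_normed_vector) set" where
  "pettis_functions =
     {f. (\<forall>t. t \<notin> {0..1} \<longrightarrow> f t = 0) \<and> strongly_measurable f \<and> pettis_integrable f}"

end

theory Submission
  imports Defs
begin

text \<open>
  The functions in the family are sums of blocks whose integrals over all measurable sets are tiny,
  while their primitives are very steep near every point of the unit interval.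

  Such blocks come from a weak form of the Dvoretzky--Rogers theorem: an infinite-dimensional space
  contains finite families \<open>x\<^sub>0, \<dots>, x\<^bsub>n-1\<^esub>\<close> for which the sum of the norms is as large as desired
  although all sums \<open>\<Sum> \<theta>\<^sub>k x\<^sub>k\<close> with \<open>\<bar>\<theta>\<^sub>k\<bar> \<le> 1\<close> are as small as desired (\<open>large_sum_small_range\<close>). If this
  failed, the identity of the space would be absolutely summing. Pietsch's argument would then
  give an inner product whose norm is equivalent to the given one (\<open>pietsch\<close>), and in an orthonormal
  family of \<open>n\<close> vectors the sum of the norms has order \<open>n\<close>, whereas the sums with coefficients
  \<open>\<theta>\<^sub>k\<close> have order \<open>sqrt n\<close>, which is absurd for large \<open>n\<close>.

  Given a family with \<open>\<Sum> norm x\<^sub>k = R\<close>, cut the unit interval into cells of length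
  \<open>norm x\<^sub>k / R\<close> and let the block be the multiple of \<open>x\<^sub>k\<close> on an initial piece of the \<open>k\<close>-th cell whose
  integral is \<open>x\<^sub>k\<close>. Its primitive has mean slope \<open>R\<close> over every cell, and all its integrals are of the
  form \<open>\<Sum> \<theta>\<^sub>k x\<^sub>k\<close> with \<open>0 \<le> \<theta>\<^sub>k \<le> 1\<close>, hence small (\<open>steep_block_exists\<close>). The initial pieces may be
  as short as desired. With a summable choice of their total lengths, the Borel--Cantelli lemma leaves only
  finitely many nonzero blocks at almost every point, and setting all blocks to zero on the
  exceptional null set removes every question of pointwise convergence.

  The blocks \<open>h\<^sub>i\<close> are chosen one after the other as a gliding hump (\<open>steep_sequence\<close>): the slope of \<open>h\<^sub>i\<close>
  dominates the Lipschitz constants of the primitives of its predecessors, and the integrals of its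
  successors are negligible compared with the shortest cell of \<open>h\<^sub>i\<close>. For a bounded
  sequence \<open>\<beta>\<close> the function \<open>\<Sum> \<beta>\<^sub>i h\<^sub>i\<close> is then strongly measurable and Pettis integrable, and if
  \<open>\<bar>\<beta>\<^sub>i\<bar>\<close> is bounded below along an infinite set of indices, its primitive has unbounded
  difference quotients at every point: the point lies in some cell of each \<open>h\<^sub>i\<close>, and one of
  the two endpoints of that cell inherits its slope (\<open>steep_increments\<close>).

  It remains to find continuum many \<open>0\<close>-\<open>1\<close>-sequences \<open>\<beta>\<close> all of whose nontrivial \<open>\<ell>\<^sub>1\<close>-combinations are
  bounded below along an infinite set. Indicators of an almost disjoint family of
  infinite sets of natural numbers do this: far out on one of the sets only its own coefficient and
  an arbitrarily small remainder are seen (\<open>l1_combination_of_branches\<close>). The same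
  observation for finite sums gives linear independence, and injectivity of the parametrisation by the reals.
\<close>

section \<open>Linear functionals below a sublinear functional\<close>

definition sublinear :: "('v::real_vector \<Rightarrow> real) \<Rightarrow> bool" where
  "sublinear p \<longleftrightarrow> (\<forall>x y. p (x + y) \<le> p x + p y) \<and> (\<forall>r x. 0 \<le> r \<longrightarrow> p (r *\<^sub>R x) = r * p x)"

lemma sublinearI:
  assumes "\<And>x y. p (x + y) \<le> p x + p y"
    and "\<And>r x. 0 < r \<Longrightarrow> p (r *\<^sub>R x) \<le> r * p x" and "p 0 = 0"
  shows "sublinear p"
proof -
  have "p (r *\<^sub>R x) = r * p x" if "0 \<le> r" for r x
  proof (cases "r = 0")
    case True
    then show ?thesis using assms(3) by simp
  next
    case False
    with that have "0 < r" by simp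
    have "p x = p (inverse r *\<^sub>R (r *\<^sub>R x))" using \<open>0 < r\<close> by simp
    also have "\<dots> \<le> inverse r * p (r *\<^sub>R x)" using \<open>0 < r\<close> by (intro assms(2)) simp
    finally have "r * p x \<le> p (r *\<^sub>R x)" using \<open>0 < r\<close> by (simp add: field_simps)
    with assms(2)[OF \<open>0 < r\<close>, of x] show ?thesis by simp
  qed
  with assms(1) show ?thesis by (auto simp: sublinear_def)
qed

lemma sublinear_add: "sublinear p \<Longrightarrow> p (x + y) \<le> p x + p y"
  by (simp add: sublinear_def)

lemma sublinear_scale: "sublinear p \<Longrightarrow> 0 \<le> r \<Longrightarrow> p (r *\<^sub>R x) = r * p x"
  by (simp add: sublinear_def)

lemma sublinear_zero: "sublinear p \<Longrightarrow> p 0 = 0"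
  using sublinear_scale[of p 0 0] by simp

lemma sublinear_ge_neg: "sublinear p \<Longrightarrow> - p (- x) \<le> p x"
  using sublinear_add[of p x "- x"] sublinear_zero[of p] by simp

text \<open>
  For sublinear \<open>p\<close> this is the largest sublinear functional below \<open>p\<close> with the value \<open>- p y\<close> at \<open>- y\<close>. It serves twice: it shows that minimal sublinear functionals
  are additive, and a linear functional below it attains \<open>p\<close> at \<open>y\<close>.
\<close>

definition tilt :: "('v::real_vector \<Rightarrow> real) \<Rightarrow> 'v \<Rightarrow> 'v \<Rightarrow> real" where
  "tilt p y x = (INF t\<in>{0..}. p (x + t *\<^sub>R y) - t * p y)"

lemma tilt_bdd:
  assumes "sublinear p"
  shows "bdd_below ((\<lambda>t. p (x + t *\<^sub>R y) - t * p y) ` {0..})"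
proof (rule bdd_belowI2)
  fix t :: real assume "t \<in> {0..}"
  then have "t * p y = p (t *\<^sub>R y)" using assms by (simp add: sublinear_scale)
  also have "\<dots> = p ((x + t *\<^sub>R y) + (- x))" by simp
  also have "\<dots> \<le> p (x + t *\<^sub>R y) + p (- x)" using assms by (rule sublinear_add)
  finally show "- p (- x) \<le> p (x + t *\<^sub>R y) - t * p y" by simp
qed

lemma tilt_le:
  assumes "sublinear p" "0 \<le> t"
  shows "tilt p y x \<le> p (x + t *\<^sub>R y) - t * p y"
  unfolding tilt_def using assms by (intro cINF_lower tilt_bdd) auto

lemma sublinear_tilt:
  assumes p: "sublinear p"
  shows "sublinear (tilt p y)"
proof (rule sublinearI)
  fix x x'
  have "tilt p y (x + x') - (p (x + t *\<^sub>R y) - t * p y) \<le> tilt p y x'" if "0 \<le> t" for t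
    unfolding tilt_def[of p y x']
  proof (rule cINF_greatest)
    fix t' :: real assume "t' \<in> {0..}"
    then have "tilt p y (x + x') \<le> p ((x + x') + (t + t') *\<^sub>R y) - (t + t') * p y"
      using that by (intro tilt_le p) auto
    also have "p ((x + x') + (t + t') *\<^sub>R y) \<le> p (x + t *\<^sub>R y) + p (x' + t' *\<^sub>R y)"
      using sublinear_add[OF p, of "x + t *\<^sub>R y" "x' + t' *\<^sub>R y"] by (simp add: algebra_simps)
    finally show "tilt p y (x + x') - (p (x + t *\<^sub>R y) - t * p y) \<le> p (x' + t' *\<^sub>R y) - t' * p y"
      by (simp add: algebra_simps)
  qed auto
  then have "tilt p y (x + x') - tilt p y x' \<le> p (x + t *\<^sub>R y) - t * p y" if "0 \<le> t" for t
    using that by (simp add: algebra_simps)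
  then have "tilt p y (x + x') - tilt p y x' \<le> tilt p y x"
    unfolding tilt_def[of p y x] by (intro cINF_greatest) auto
  then show "tilt p y (x + x') \<le> tilt p y x + tilt p y x'" by simp
next
  fix r :: real and x assume r: "0 < r"
  have "tilt p y (r *\<^sub>R x) / r \<le> tilt p y x"
    unfolding tilt_def[of p y x]
  proof (rule cINF_greatest)
    fix t :: real assume t: "t \<in> {0..}"
    then have "tilt p y (r *\<^sub>R x) \<le> p (r *\<^sub>R x + (r * t) *\<^sub>R y) - (r * t) * p y"
      using r by (intro tilt_le p) auto
    moreover have "p (r *\<^sub>R x + (r * t) *\<^sub>R y) = r * p (x + t *\<^sub>R y)"
      using r by (simp add: sublinear_scale[OF p, symmetric] algebra_simps)
    ultimately show "tilt p y (r *\<^sub>R x) / r \<le> p (x + t *\<^sub>R y) - t * p y"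
      using r by (simp add: field_simps)
  qed auto
  then show "tilt p y (r *\<^sub>R x) \<le> r * tilt p y x" using r by (simp add: field_simps)
next
  have "tilt p y 0 = (INF t\<in>{0::real..}. 0)"
    unfolding tilt_def by (rule INF_cong) (auto simp: sublinear_scale[OF p])
  then show "tilt p y 0 = 0" by simp
qed

text \<open>
  Minimality forces every tilt of \<open>p\<close> to coincide with \<open>p\<close>, and the term \<open>t = 1\<close> of the
  infimum defining the tilt is then superadditivity.
\<close>

lemma minimal_sublinear_linear:
  assumes p: "sublinear p" and min: "\<And>q. sublinear q \<Longrightarrow> (\<And>x. q x \<le> p x) \<Longrightarrow> q = p"
  shows "linear p"
proof -
  have eq: "tilt p y = p" for y
    using tilt_le[OF p, of 0 y] by (intro min sublinear_tilt p) simp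
  have add: "p (x + y) = p x + p y" for x y
  proof (rule antisym)
    show "p (x + y) \<le> p x + p y" using p by (rule sublinear_add)
    have "p x \<le> p (x + 1 *\<^sub>R y) - 1 * p y"
      using tilt_le[OF p, of 1 y x] by (simp add: eq)
    then show "p x + p y \<le> p (x + y)" by simp
  qed
  have neg: "p (- x) = - p x" for x
    using add[of x "- x"] sublinear_zero[OF p] by simp
  show ?thesis
  proof (rule linearI)
    show "p (r *\<^sub>R x) = r *\<^sub>R p x" for r x
    proof (cases "0 \<le> r")
      case True
      then show ?thesis by (simp add: sublinear_scale[OF p])
    next
      case False
      then show ?thesis
        using sublinear_scale[OF p, of "- r" x] neg[of "r *\<^sub>R x"] by simp
    qed
  qed (rule add)
qed

text \<open>
  Subadditivity survives the infimum because two members of a chain can be replaced by the smaller one;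
  the bound \<open>q x \<ge> - q (- x) \<ge> - s (- x)\<close> keeps the infimum finite.
\<close>

lemma sublinear_INF_chain:
  assumes s: "sublinear s" and "C \<noteq> {}"
    and C: "\<And>q. q \<in> C \<Longrightarrow> sublinear q \<and> (\<forall>x. q x \<le> s x)"
    and chain: "\<And>q q'. q \<in> C \<Longrightarrow> q' \<in> C \<Longrightarrow> (\<forall>x. q x \<le> q' x) \<or> (\<forall>x. q' x \<le> q x)"
  shows "sublinear (\<lambda>x. INF q\<in>C. q x)" and "\<And>q x. q \<in> C \<Longrightarrow> (INF q\<in>C. q x) \<le> q x"
proof -
  have bdd: "bdd_below ((\<lambda>q. q x) ` C)" for x
  proof (rule bdd_belowI2)
    fix q assume "q \<in> C"
    then have "- q (- x) \<le> q x" "q (- x) \<le> s (- x)" using C sublinear_ge_neg by blast+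
    then show "- s (- x) \<le> q x" by simp
  qed
  show le: "(INF q\<in>C. q x) \<le> q x" if "q \<in> C" for q x
    using that by (rule cINF_lower[OF bdd])
  show "sublinear (\<lambda>x. INF q\<in>C. q x)"
  proof (rule sublinearI)
    fix x y
    have *: "(INF q\<in>C. q (x + y)) \<le> q x + q' y" if q: "q \<in> C" "q' \<in> C" for q q'
      using chain[OF q]
    proof
      assume "\<forall>x. q x \<le> q' x"
      then have "q (x + y) \<le> q x + q' y"
        using sublinear_add[of q x y] C[OF q(1)] by (smt (verit))
      with le[OF q(1)] show ?thesis by (rule order_trans)
    next
      assume "\<forall>x. q' x \<le> q x"
      then have "q' (x + y) \<le> q x + q' y"
        using sublinear_add[of q' x y] C[OF q(2)] by (smt (verit))
      with le[OF q(2)] show ?thesis by (rule order_trans)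
    qed
    have "(INF q\<in>C. q (x + y)) - q x \<le> (INF q\<in>C. q y)" if "q \<in> C" for q
      using \<open>C \<noteq> {}\<close> *[OF that] by (intro cINF_greatest) (auto simp: algebra_simps)
    then have "(INF q\<in>C. q (x + y)) - (INF q\<in>C. q y) \<le> (INF q\<in>C. q x)"
      using \<open>C \<noteq> {}\<close> by (intro cINF_greatest) (auto simp: algebra_simps)
    then show "(INF q\<in>C. q (x + y)) \<le> (INF q\<in>C. q x) + (INF q\<in>C. q y)" by simp
  next
    fix r :: real and x assume r: "0 < r"
    have "(INF q\<in>C. q (r *\<^sub>R x)) / r \<le> (INF q\<in>C. q x)"
    proof (rule cINF_greatest[OF \<open>C \<noteq> {}\<close>])
      fix q assume "q \<in> C"
      with le[OF this, of "r *\<^sub>R x"] C[OF this] r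
      show "(INF q\<in>C. q (r *\<^sub>R x)) / r \<le> q x" by (simp add: sublinear_scale field_simps)
    qed
    then show "(INF q\<in>C. q (r *\<^sub>R x)) \<le> r * (INF q\<in>C. q x)" using r by (simp add: field_simps)
  next
    have "(INF q\<in>C. q 0) = (INF q\<in>C. 0)"
      by (rule INF_cong) (auto dest: C simp: sublinear_zero)
    then show "(INF q\<in>C. q 0) = 0" using \<open>C \<noteq> {}\<close> by simp
  qed
qed

text \<open>
  The Hahn--Banach theorem: Zorn's lemma yields a minimal sublinear functional below \<open>s\<close>, and minimal
  ones are linear.
\<close>

lemma sublinear_dominates_linear:
  assumes s: "sublinear s"
  obtains L where "linear L" "\<And>x. L x \<le> s x"
proof -
  define A where "A = {q. sublinear q \<and> (\<forall>x. q x \<le> s x)}"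
  define P where "P = (\<lambda>q q' :: 'a \<Rightarrow> real. \<forall>x. q' x \<le> q x)"
  have "\<exists>m\<in>A. \<forall>a\<in>A. P m a \<longrightarrow> a = m"
  proof (rule predicate_Zorn)
    show "partial_order_on A (relation_of P A)"
    proof (rule partial_order_on_relation_ofI)
      show "P a c" if "P a b" "P b c" for a b c
        using that unfolding P_def by (meson order_trans)
      show "a = b" if "P a b" "P b a" for a b
        using that unfolding P_def by (auto intro!: ext antisym)
    qed (simp add: P_def)
    fix C assume Ch: "C \<in> Chains (relation_of P A)"
    show "\<exists>u\<in>A. \<forall>a\<in>C. P a u"
    proof (cases "C = {}")
      case True
      then show ?thesis using s by (auto simp: A_def)
    next
      case False
      have C: "sublinear q \<and> (\<forall>x. q x \<le> s x)" if "q \<in> C" for q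
        using that Ch by (auto simp: Chains_def relation_of_def A_def)
      have ch: "(\<forall>x. q x \<le> q' x) \<or> (\<forall>x. q' x \<le> q x)" if "q \<in> C" "q' \<in> C" for q q'
        using that Ch by (auto simp: Chains_def relation_of_def P_def)
      have inf: "sublinear (\<lambda>x. INF q\<in>C. q x)" "\<And>q x. q \<in> C \<Longrightarrow> (INF q\<in>C. q x) \<le> q x"
        using sublinear_INF_chain[OF s False] C ch by blast+
      obtain q where "q \<in> C" using False by blast
      have "(INF q\<in>C. q x) \<le> s x" for x
      proof -
        have "(INF q\<in>C. q x) \<le> q x" using \<open>q \<in> C\<close> by (rule inf(2))
        also have "q x \<le> s x" using C[OF \<open>q \<in> C\<close>] by blast
        finally show ?thesis .
      qed
      with inf(1) have "(\<lambda>x. INF q\<in>C. q x) \<in> A" by (simp add: A_def)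
      moreover have "\<forall>a\<in>C. P a (\<lambda>x. INF q\<in>C. q x)" using inf(2) by (simp add: P_def)
      ultimately show ?thesis by blast
    qed
  qed
  then obtain m where m: "m \<in> A" "\<And>q. q \<in> A \<Longrightarrow> P m q \<Longrightarrow> q = m" by blast
  have "linear m"
  proof (rule minimal_sublinear_linear)
    show "sublinear m" using m(1) by (simp add: A_def)
    fix q assume "sublinear q" and "\<And>x. q x \<le> m x"
    moreover from this m(1) have "q x \<le> s x" for x
      using order_trans[of "q x" "m x" "s x"] by (simp add: A_def)
    ultimately show "q = m" by (intro m(2)) (auto simp: A_def P_def)
  qed
  with m(1) that show ?thesis by (auto simp: A_def)
qed

text \<open>
  A linear functional below the tilt of the norm towards \<open>y\<close> is at most \<open>- norm y\<close> at \<open>- y\<close>.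
\<close>

lemma norming_functional:
  fixes y :: "'a::real_normed_vector"
  obtains \<phi> :: "'a \<Rightarrow>\<^sub>L real" where "norm \<phi> \<le> 1" "blinfun_apply \<phi> y = norm y"
proof -
  have s: "sublinear (norm :: 'a \<Rightarrow> real)"
    by (rule sublinearI) (auto simp: norm_triangle_ineq)
  obtain L where L: "linear L" "\<And>x. L x \<le> tilt norm y x"
    using sublinear_dominates_linear[OF sublinear_tilt[OF s]] by metis
  have le: "L x \<le> norm x" for x
    using L(2)[of x] tilt_le[OF s, of 0 y x] by simp
  have abs: "\<bar>L x\<bar> \<le> norm x" for x
    using le[of x] le[of "- x"] linear_neg[OF L(1), of x] by (simp add: abs_le_iff)
  have "L (- y) \<le> - norm y"
    using L(2)[of "- y"] tilt_le[OF s, of 1 y "- y"] by simp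
  then have "L y = norm y"
    using le[of y] linear_neg[OF L(1), of y] by simp
  have bl: "bounded_linear L"
    using L(1) abs by (auto simp: bounded_linear_def bounded_linear_axioms_def intro!: exI[of _ 1])
  have "norm (Blinfun L) \<le> 1"
    using abs by (intro norm_blinfun_bound) (auto simp: bounded_linear_Blinfun_apply[OF bl])
  with \<open>L y = norm y\<close> show ?thesis
    by (intro that[of "Blinfun L"]) (auto simp: bounded_linear_Blinfun_apply[OF bl])
qed

lemma functionals_separate:
  fixes v w :: "'a::real_normed_vector"
  assumes "\<And>\<phi> :: 'a \<Rightarrow>\<^sub>L real. blinfun_apply \<phi> v = blinfun_apply \<phi> w"
  shows "v = w"
proof -
  obtain \<phi> :: "'a \<Rightarrow>\<^sub>L real" where "blinfun_apply \<phi> (v - w) = norm (v - w)"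
    using norming_functional by blast
  with assms show ?thesis by (simp add: blinfun.diff_right)
qed

text \<open>
  The separation form of Hahn--Banach, in the shape needed for Pietsch's theorem. A linear functional below
  the infimum of \<open>s (g + k)\<close> over the cone lies below \<open>s\<close> (take \<open>k = 0\<close>), and it is at most \<open>0\<close> at
  \<open>- k\<close> because \<open>s (- k + k) = 0\<close>.
\<close>

lemma linear_nonneg_on_cone:
  fixes s :: "'v::real_vector \<Rightarrow> real"
  assumes s: "sublinear s" and "0 \<in> C"
    and add: "\<And>k k'. k \<in> C \<Longrightarrow> k' \<in> C \<Longrightarrow> k + k' \<in> C"
    and scale: "\<And>r k. 0 < r \<Longrightarrow> k \<in> C \<Longrightarrow> r *\<^sub>R k \<in> C"
    and nonneg: "\<And>k. k \<in> C \<Longrightarrow> 0 \<le> s k"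
  shows "\<exists>L. linear L \<and> (\<forall>g. L g \<le> s g) \<and> (\<forall>k\<in>C. 0 \<le> L k)"
proof -
  define p where "p g = (INF k\<in>C. s (g + k))" for g
  have ne: "C \<noteq> {}" using \<open>0 \<in> C\<close> by blast
  have bdd: "bdd_below ((\<lambda>k. s (g + k)) ` C)" for g
  proof (rule bdd_belowI2)
    fix k assume "k \<in> C"
    then show "- s (- g) \<le> s (g + k)"
      using nonneg[of k] sublinear_add[OF s, of "g + k" "- g"] by simp
  qed
  have le: "p g \<le> s (g + k)" if "k \<in> C" for g k
    unfolding p_def using that by (rule cINF_lower[OF bdd])
  have "sublinear p"
  proof (rule sublinearI)
    fix g g'
    have *: "p (g + g') \<le> s (g + k) + s (g' + k')" if "k \<in> C" "k' \<in> C" for k k'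
      using le[OF add[OF that], of "g + g'"] sublinear_add[OF s, of "g + k" "g' + k'"]
      by (simp add: algebra_simps)
    have "p (g + g') - s (g + k) \<le> p g'" if "k \<in> C" for k
      unfolding p_def[of g'] using *[OF that] by (intro cINF_greatest[OF ne]) (simp add: algebra_simps)
    then have "p (g + g') - p g' \<le> p g"
      unfolding p_def[of g] by (intro cINF_greatest[OF ne]) (simp add: algebra_simps)
    then show "p (g + g') \<le> p g + p g'" by simp
  next
    fix r :: real and g assume r: "0 < r"
    have "p (r *\<^sub>R g) / r \<le> p g"
      unfolding p_def[of g]
    proof (rule cINF_greatest[OF ne])
      fix k assume "k \<in> C"
      from le[OF scale[OF r this], of "r *\<^sub>R g"]
      have "p (r *\<^sub>R g) \<le> s (r *\<^sub>R (g + k))" by (simp add: algebra_simps)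
      also have "\<dots> = r * s (g + k)" using s r by (intro sublinear_scale) auto
      finally show "p (r *\<^sub>R g) / r \<le> s (g + k)" using r by (simp add: field_simps)
    qed
    then show "p (r *\<^sub>R g) \<le> r * p g" using r by (simp add: field_simps)
  next
    have "0 \<le> p 0" unfolding p_def using nonneg by (intro cINF_greatest[OF ne]) simp
    moreover have "p 0 \<le> 0" using le[OF \<open>0 \<in> C\<close>, of 0] sublinear_zero[OF s] by simp
    ultimately show "p 0 = 0" by simp
  qed
  then obtain L where L: "linear L" "\<And>g. L g \<le> p g" using sublinear_dominates_linear by blast
  show ?thesis
  proof (intro exI conjI allI ballI, rule L(1))
    show "L g \<le> s g" for g using L(2)[of g] le[OF \<open>0 \<in> C\<close>, of g] by simp
    show "0 \<le> L k" if "k \<in> C" for k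
      using L(2)[of "- k"] le[OF that, of "- k"] sublinear_zero[OF s] linear_neg[OF L(1), of k] by simp
  qed
qed

section \<open>A weak Dvoretzky--Rogers theorem\<close>

lemma bdd_above_bcontfun: "bdd_above (range (apply_bcontfun (g :: 'b::topological_space \<Rightarrow>\<^sub>C real)))"
  by (rule bdd_aboveI2[where M="norm g"]) (use norm_bounded[of g] in \<open>auto simp: abs_le_iff\<close>)

lemma bcontfun_le_SUP: "apply_bcontfun (g :: 'b::topological_space \<Rightarrow>\<^sub>C real) x \<le> (SUP y. apply_bcontfun g y)"
  by (rule cSUP_upper[OF _ bdd_above_bcontfun]) simp

lemma sublinear_SUP_bcontfun: "sublinear (\<lambda>g :: 'b::topological_space \<Rightarrow>\<^sub>C real. SUP x. apply_bcontfun g x)"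
proof (rule sublinearI)
  fix g h :: "'b \<Rightarrow>\<^sub>C real"
  show "(SUP x. apply_bcontfun (g + h) x) \<le> (SUP x. apply_bcontfun g x) + (SUP x. apply_bcontfun h x)"
    by (rule cSUP_least) (simp_all add: add_mono bcontfun_le_SUP)
next
  fix r :: real and g :: "'b \<Rightarrow>\<^sub>C real" assume "0 < r"
  then show "(SUP x. apply_bcontfun (r *\<^sub>R g) x) \<le> r * (SUP x. apply_bcontfun g x)"
    by (intro cSUP_least) (simp_all add: bcontfun_le_SUP)
qed simp

text \<open>
  The evaluation \<open>\<phi> \<mapsto> \<phi> x * \<phi> y\<close> is quadratic in \<open>\<phi>\<close>; dividing by \<open>1 + norm \<phi> ^ 2\<close> turns it into a
  bounded continuous function on the whole dual. Up to a factor \<open>2\<close> this is as good as restricting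
  \<open>\<phi>\<close> to the unit ball.
\<close>

definition dual_product :: "'a \<Rightarrow> 'a::real_normed_vector \<Rightarrow> ('a \<Rightarrow>\<^sub>L real) \<Rightarrow>\<^sub>C real" where
  "dual_product x y = Bcontfun (\<lambda>\<phi>. blinfun_apply \<phi> x * blinfun_apply \<phi> y / (1 + (norm \<phi>)\<^sup>2))"

lemma apply_dual_product:
  "apply_bcontfun (dual_product x y) \<phi> = blinfun_apply \<phi> x * blinfun_apply \<phi> y / (1 + (norm \<phi>)\<^sup>2)"
proof -
  have pos: "0 < 1 + (norm \<psi>)\<^sup>2" for \<psi> :: "'a \<Rightarrow>\<^sub>L real" by (simp add: add_pos_nonneg)
  have "(\<lambda>\<phi>. blinfun_apply \<phi> x * blinfun_apply \<phi> y / (1 + (norm \<phi>)\<^sup>2)) \<in> bcontfun"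
  proof (rule bcontfun_normI)
    show "continuous_on UNIV (\<lambda>\<phi>. blinfun_apply \<phi> x * blinfun_apply \<phi> y / (1 + (norm \<phi>)\<^sup>2))"
      using pos by (intro continuous_intros) (metis less_irrefl)
    fix \<psi> :: "'a \<Rightarrow>\<^sub>L real"
    have "\<bar>blinfun_apply \<psi> x\<bar> * \<bar>blinfun_apply \<psi> y\<bar> \<le> (norm \<psi> * norm x) * (norm \<psi> * norm y)"
      using norm_blinfun[of \<psi> x] norm_blinfun[of \<psi> y] by (intro mult_mono) auto
    also have "\<dots> = (norm x * norm y) * (norm \<psi>)\<^sup>2" by (simp add: power2_eq_square)
    also have "\<dots> \<le> (norm x * norm y) * (1 + (norm \<psi>)\<^sup>2)" by (intro mult_left_mono) auto
    finally show "norm (blinfun_apply \<psi> x * blinfun_apply \<psi> y / (1 + (norm \<psi>)\<^sup>2)) \<le> norm x * norm y"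
      using pos[of \<psi>] by (simp add: abs_mult field_simps)
  qed
  then show ?thesis by (simp add: dual_product_def Bcontfun_inverse)
qed

definition signed_sums_le :: "nat \<Rightarrow> (nat \<Rightarrow> 'a::real_normed_vector) \<Rightarrow> real \<Rightarrow> bool" where
  "signed_sums_le n x M \<longleftrightarrow> (\<forall>\<theta>. (\<forall>k<n. \<bar>\<theta> k\<bar> \<le> 1) \<longrightarrow> norm (\<Sum>k<n. \<theta> k *\<^sub>R x k) \<le> M)"

lemma signed_sums_leI:
  "(\<And>\<theta>. (\<And>k. k < n \<Longrightarrow> \<bar>\<theta> k\<bar> \<le> 1) \<Longrightarrow> norm (\<Sum>k<n. \<theta> k *\<^sub>R x k) \<le> M) \<Longrightarrow> signed_sums_le n x M"
  by (simp add: signed_sums_le_def)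

lemma signed_sums_leD:
  "signed_sums_le n x M \<Longrightarrow> (\<And>k. k < n \<Longrightarrow> \<bar>\<theta> k\<bar> \<le> 1) \<Longrightarrow> norm (\<Sum>k<n. \<theta> k *\<^sub>R x k) \<le> M"
  by (simp add: signed_sums_le_def)

text \<open>
  Up to the factor \<open>2\<close> between \<open>dual_product\<close> and the unit ball, this says that the identity of the
  space is an absolutely 2-summing operator with constant \<open>sqrt K\<close>. The type argument only names the space.
\<close>

definition two_summing :: "'a::real_normed_vector itself \<Rightarrow> real \<Rightarrow> bool" where
  "two_summing _ K \<longleftrightarrow> (\<forall>(xs :: 'a list) S.
     (\<forall>\<phi>. (\<Sum>x\<leftarrow>xs. apply_bcontfun (dual_product x x) \<phi>) \<le> S) \<longrightarrow> (\<Sum>x\<leftarrow>xs. (norm x)\<^sup>2) \<le> K * S)"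

text \<open>
  Pietsch's domination theorem for the identity, with the dominating measure replaced by a
  positive functional \<open>L\<close> on the bounded continuous functions of the dual, and the inner product
  \<open>Q x y = L (dual_product x y)\<close>. The 2-summing property says exactly that all functions
  in the convex cone generated by \<open>K * dual_product x x - norm x ^ 2\<close> have a nonnegative
  supremum, so \<open>L\<close> can be chosen nonnegative on this cone, which is the lower estimate for \<open>Q\<close>.
\<close>

lemma pietsch:
  assumes sum: "two_summing TYPE('a::real_normed_vector) K" and K: "0 < K"
  obtains Q :: "'a::real_normed_vector \<Rightarrow> 'a \<Rightarrow> real" where "\<And>y. linear (\<lambda>x. Q x y)" "\<And>x y. Q x y = Q y x"
    "\<And>x. Q x x \<le> (norm x)\<^sup>2" "\<And>x. (norm x)\<^sup>2 \<le> K * Q x x"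
proof -
  define C where "C = {g :: ('a \<Rightarrow>\<^sub>L real) \<Rightarrow>\<^sub>C real. \<exists>xs. \<forall>\<phi>. apply_bcontfun g \<phi> =
    K * (\<Sum>x\<leftarrow>xs. apply_bcontfun (dual_product x x) \<phi>) - (\<Sum>x\<leftarrow>xs. (norm x)\<^sup>2)}"
  let ?s = "\<lambda>g :: ('a \<Rightarrow>\<^sub>L real) \<Rightarrow>\<^sub>C real. SUP \<phi>. apply_bcontfun g \<phi>"
  have "0 \<in> C" by (auto simp: C_def intro!: exI[of _ "[]"])
  moreover have "g + h \<in> C" if "g \<in> C" "h \<in> C" for g h
  proof -
    from that obtain xs ys where
      "\<forall>\<phi>. apply_bcontfun g \<phi> = K * (\<Sum>x\<leftarrow>xs. apply_bcontfun (dual_product x x) \<phi>) - (\<Sum>x\<leftarrow>xs. (norm x)\<^sup>2)"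
      "\<forall>\<phi>. apply_bcontfun h \<phi> = K * (\<Sum>x\<leftarrow>ys. apply_bcontfun (dual_product x x) \<phi>) - (\<Sum>x\<leftarrow>ys. (norm x)\<^sup>2)"
      by (auto simp: C_def)
    then have "\<forall>\<phi>. apply_bcontfun (g + h) \<phi> =
        K * (\<Sum>x\<leftarrow>xs @ ys. apply_bcontfun (dual_product x x) \<phi>) - (\<Sum>x\<leftarrow>xs @ ys. (norm x)\<^sup>2)"
      by (simp add: distrib_left)
    then show ?thesis unfolding C_def by blast
  qed
  moreover have "r *\<^sub>R g \<in> C" if r: "0 < r" and "g \<in> C" for r g
  proof -
    from that obtain xs where
      xs: "\<And>\<phi>. apply_bcontfun g \<phi> = K * (\<Sum>x\<leftarrow>xs. apply_bcontfun (dual_product x x) \<phi>) - (\<Sum>x\<leftarrow>xs. (norm x)\<^sup>2)"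
      by (auto simp: C_def)
    have *: "apply_bcontfun (dual_product (sqrt r *\<^sub>R x) (sqrt r *\<^sub>R x)) \<phi>
        = r * apply_bcontfun (dual_product x x) \<phi>" for x :: 'a and \<phi>
      using r by (simp add: apply_dual_product blinfun.scaleR_right)
    have **: "(norm (sqrt r *\<^sub>R x))\<^sup>2 = r * (norm x)\<^sup>2" for x :: 'a
      using r by (simp add: power_mult_distrib)
    have "apply_bcontfun (r *\<^sub>R g) \<phi> =
        K * (\<Sum>x\<leftarrow>map (\<lambda>x. sqrt r *\<^sub>R x) xs. apply_bcontfun (dual_product x x) \<phi>)
          - (\<Sum>x\<leftarrow>map (\<lambda>x. sqrt r *\<^sub>R x) xs. (norm x)\<^sup>2)" for \<phi>
      by (simp only: map_map o_def * ** sum_list_const_mult) (simp add: xs algebra_simps)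
    then show ?thesis unfolding C_def by blast
  qed
  moreover have "0 \<le> ?s g" if "g \<in> C" for g
  proof -
    from that obtain xs where
      xs: "\<And>\<phi>. apply_bcontfun g \<phi> = K * (\<Sum>x\<leftarrow>xs. apply_bcontfun (dual_product x x) \<phi>) - (\<Sum>x\<leftarrow>xs. (norm x)\<^sup>2)"
      by (auto simp: C_def)
    have "(\<Sum>x\<leftarrow>xs. apply_bcontfun (dual_product x x) \<phi>) \<le> (?s g + (\<Sum>x\<leftarrow>xs. (norm x)\<^sup>2)) / K" for \<phi>
      using bcontfun_le_SUP[of g \<phi>] K by (simp add: xs field_simps)
    then have "(\<Sum>x\<leftarrow>xs. (norm x)\<^sup>2) \<le> K * ((?s g + (\<Sum>x\<leftarrow>xs. (norm x)\<^sup>2)) / K)"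
      using sum unfolding two_summing_def by blast
    then show ?thesis using K by simp
  qed
  ultimately have "\<exists>L. linear L \<and> (\<forall>g. L g \<le> ?s g) \<and> (\<forall>k\<in>C. 0 \<le> L k)"
    by (rule linear_nonneg_on_cone[OF sublinear_SUP_bcontfun])
  then obtain L where L: "linear L" "\<And>g. L g \<le> ?s g" "\<And>g. g \<in> C \<Longrightarrow> 0 \<le> L g" by blast
  define Q where "Q x y = L (dual_product x y)" for x y :: 'a
  show ?thesis
  proof (rule that)
    fix x y :: 'a
    show "Q x y = Q y x"
      unfolding Q_def by (rule arg_cong[of _ _ L]) (auto intro!: bcontfun_eqI simp: apply_dual_product)
    show "linear (\<lambda>x. Q x y)"
    proof (rule linearI)
      fix x z :: 'a and r :: real
      have "dual_product (x + z) y = dual_product x y + dual_product z y"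
        by (rule bcontfun_eqI) (simp add: apply_dual_product blinfun.add_right add_divide_distrib algebra_simps)
      then show "Q (x + z) y = Q x y + Q z y" by (simp add: Q_def linear_add[OF L(1)])
      have "dual_product (r *\<^sub>R x) y = r *\<^sub>R dual_product x y"
        by (rule bcontfun_eqI) (simp add: apply_dual_product blinfun.scaleR_right)
      then show "Q (r *\<^sub>R x) y = r *\<^sub>R Q x y" by (simp add: Q_def linear_scale[OF L(1)])
    qed
    have le: "apply_bcontfun (dual_product x x) \<phi> \<le> (norm x)\<^sup>2" for \<phi>
    proof -
      have "(blinfun_apply \<phi> x)\<^sup>2 \<le> (norm \<phi> * norm x)\<^sup>2"
        using norm_blinfun[of \<phi> x] by (intro power2_le_iff_abs_le[THEN iffD2]) auto
      also have "\<dots> \<le> (norm x)\<^sup>2 * (1 + (norm \<phi>)\<^sup>2)" by (simp add: power_mult_distrib algebra_simps)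
      finally show ?thesis
        by (simp add: apply_dual_product power2_eq_square[of "blinfun_apply \<phi> x", symmetric]
            add_pos_nonneg pos_divide_le_eq)
    qed
    have "Q x x \<le> ?s (dual_product x x)" unfolding Q_def by (rule L(2))
    also have "\<dots> \<le> (norm x)\<^sup>2" using le by (intro cSUP_least) auto
    finally show "Q x x \<le> (norm x)\<^sup>2" .
    define c where "c = const_bcontfun ((norm x)\<^sup>2) - K *\<^sub>R dual_product x x"
    have "- c \<in> C"
      unfolding C_def c_def by (auto intro!: exI[of _ "[x]"] simp: const_bcontfun.rep_eq)
    then have "L c \<le> 0" using L(3)[of "- c"] linear_neg[OF L(1), of c] by simp
    have "L (- const_bcontfun ((norm x)\<^sup>2)) \<le> ?s (- const_bcontfun ((norm x)\<^sup>2))" by (rule L(2))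
    also have "\<dots> = - (norm x)\<^sup>2" by (simp add: const_bcontfun.rep_eq)
    finally have "(norm x)\<^sup>2 \<le> L (const_bcontfun ((norm x)\<^sup>2))"
      by (simp add: linear_neg[OF L(1)])
    with \<open>L c \<le> 0\<close> show "(norm x)\<^sup>2 \<le> K * Q x x"
      by (simp add: c_def Q_def linear_diff[OF L(1)] linear_scale[OF L(1)])
  qed
qed

text \<open>
  The Gram--Schmidt procedure does not stop, because no finite set spans the space.
\<close>

lemma orthonormal_family:
  fixes Q :: "'a::real_vector \<Rightarrow> 'a \<Rightarrow> real"
  assumes inf_dim: "\<not> (\<exists>B :: 'a set. finite B \<and> span B = UNIV)"
    and lin: "\<And>y. linear (\<lambda>x. Q x y)" and sym: "\<And>x y. Q x y = Q y x"
    and pos: "\<And>x. x \<noteq> 0 \<Longrightarrow> 0 < Q x x"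
  shows "\<exists>u :: nat \<Rightarrow> 'a. \<forall>i<n. \<forall>j<n. Q (u i) (u j) = of_bool (i = j)"
proof (induction n)
  case (Suc n)
  then obtain u where u: "\<And>i j. i < n \<Longrightarrow> j < n \<Longrightarrow> Q (u i) (u j) = of_bool (i = j)" by blast
  obtain v where v: "v \<notin> span (u ` {..<n})" using inf_dim by blast
  define w where "w = v - (\<Sum>i<n. Q v (u i) *\<^sub>R u i)"
  have "(\<Sum>i<n. Q v (u i) *\<^sub>R u i) \<in> span (u ` {..<n})"
    by (intro span_sum span_scale span_base) auto
  with v have "w \<noteq> 0" by (auto simp: w_def)
  then have Qw: "0 < Q w w" by (rule pos)
  have orth: "Q w (u j) = 0" if "j < n" for j
  proof -
    have "Q w (u j) = Q v (u j) - (\<Sum>i<n. Q v (u i) * Q (u i) (u j))"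
      unfolding w_def by (simp add: linear_diff[OF lin] linear_sum[OF lin] linear_scale[OF lin])
    also have "(\<Sum>i<n. Q v (u i) * Q (u i) (u j)) = (\<Sum>i<n. Q v (u i) * of_bool (i = j))"
      using that u by (intro sum.cong) auto
    also have "\<dots> = Q v (u j)" using that by (simp add: of_bool_def if_distrib[of "(*) _"] cong: if_cong)
    finally show ?thesis by simp
  qed
  define e where "e = inverse (sqrt (Q w w)) *\<^sub>R w"
  have Qe: "Q e y = inverse (sqrt (Q w w)) * Q w y" for y
    unfolding e_def by (simp add: linear_scale[OF lin])
  have "Q e e = inverse (sqrt (Q w w)) * (inverse (sqrt (Q w w)) * Q w w)"
    using Qe[of e] Qe[of w] sym[of w e] by simp
  then have "Q e e = 1" using Qw by (simp add: field_simps)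
  moreover have "Q e (u j) = 0" if "j < n" for j using orth[OF that] Qe[of "u j"] by simp
  moreover from this have "Q (u j) e = 0" if "j < n" for j using sym[of "u j" e] that by simp
  ultimately show ?case
    using u by (intro exI[of _ "u(n := e)"]) (auto simp: less_Suc_eq)
qed simp

text \<open>
  The inequality is applied to the vectors \<open>norm (x k) *\<^sub>R x k\<close>, whose norms are the squares
  \<open>norm (x k) ^ 2\<close>. A norming functional and the Cauchy--Schwarz inequality bound their sums with
  coefficients in \<open>[-1, 1]\<close> by \<open>sqrt A * sqrt (2 * S)\<close>, where \<open>A\<close> is the sum of these squares; it remains to cancel
  \<open>sqrt A\<close>.
\<close>

lemma two_summing_of_one_summing:
  assumes C: "0 < C"
    and one: "\<And>n (x :: nat \<Rightarrow> 'a::real_normed_vector) M. signed_sums_le n x M \<Longrightarrow> (\<Sum>k<n. norm (x k)) \<le> C * M"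
  shows "two_summing TYPE('a::real_normed_vector) (2 * C\<^sup>2)"
  unfolding two_summing_def
proof (intro allI impI)
  fix xs :: "'a list" and S :: real
  assume S: "\<forall>\<phi>. (\<Sum>x\<leftarrow>xs. apply_bcontfun (dual_product x x) \<phi>) \<le> S"
  define n where "n = length xs"
  define x where "x k = xs ! k" for k
  have lst: "(\<Sum>x\<leftarrow>xs. f x) = (\<Sum>k<n. f (x k))" for f :: "'a \<Rightarrow> real"
    by (simp add: sum_list_sum_nth n_def x_def atLeast0LessThan)
  define A where "A = (\<Sum>k<n. (norm (x k))\<^sup>2)"
  have "0 \<le> A" by (simp add: A_def sum_nonneg)
  have "0 \<le> S" using S[rule_format, of 0] by (simp add: apply_dual_product lst)
  have "A = (\<Sum>k<n. norm (norm (x k) *\<^sub>R x k))" by (simp add: A_def power2_eq_square)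
  also have "\<dots> \<le> C * (sqrt A * sqrt (2 * S))"
  proof (intro one signed_sums_leI)
    fix \<theta> :: "nat \<Rightarrow> real" assume \<theta>: "\<And>k. k < n \<Longrightarrow> \<bar>\<theta> k\<bar> \<le> 1"
    define y where "y = (\<Sum>k<n. \<theta> k *\<^sub>R norm (x k) *\<^sub>R x k)"
    obtain \<phi> :: "'a \<Rightarrow>\<^sub>L real" where \<phi>: "norm \<phi> \<le> 1" "blinfun_apply \<phi> y = norm y"
      by (rule norming_functional)
    have "(\<Sum>k<n. (blinfun_apply \<phi> (x k))\<^sup>2) / (1 + (norm \<phi>)\<^sup>2) \<le> S"
      using S[rule_format, of \<phi>] unfolding lst
      by (simp add: apply_dual_product power2_eq_square sum_divide_distrib)
    then have "(\<Sum>k<n. (blinfun_apply \<phi> (x k))\<^sup>2) \<le> S * (1 + (norm \<phi>)\<^sup>2)"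
      by (simp add: add_pos_nonneg pos_divide_le_eq)
    also have "\<dots> \<le> S * 2"
      using \<phi>(1) \<open>0 \<le> S\<close> power_le_one[of "norm \<phi>" 2] by (intro mult_left_mono) auto
    finally have B: "(\<Sum>k<n. (blinfun_apply \<phi> (x k))\<^sup>2) \<le> 2 * S" by simp
    have "norm y = (\<Sum>k<n. \<theta> k * (norm (x k) * blinfun_apply \<phi> (x k)))"
      unfolding \<phi>(2)[symmetric] by (simp add: y_def blinfun.sum_right blinfun.scaleR_right mult.assoc)
    also have "\<dots> \<le> (\<Sum>k<n. \<bar>norm (x k)\<bar> * \<bar>blinfun_apply \<phi> (x k)\<bar>)"
    proof (rule sum_mono)
      fix k assume "k \<in> {..<n}"
      have "\<theta> k * (norm (x k) * blinfun_apply \<phi> (x k)) \<le> \<bar>\<theta> k * (norm (x k) * blinfun_apply \<phi> (x k))\<bar>"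
        by simp
      also have "\<dots> = \<bar>\<theta> k\<bar> * (norm (x k) * \<bar>blinfun_apply \<phi> (x k)\<bar>)" by (simp add: abs_mult)
      also have "\<dots> \<le> 1 * (norm (x k) * \<bar>blinfun_apply \<phi> (x k)\<bar>)"
        using \<theta>[of k] \<open>k \<in> {..<n}\<close> by (intro mult_right_mono) auto
      finally show "\<theta> k * (norm (x k) * blinfun_apply \<phi> (x k)) \<le> \<bar>norm (x k)\<bar> * \<bar>blinfun_apply \<phi> (x k)\<bar>"
        by simp
    qed
    also have "\<dots> \<le> L2_set (\<lambda>k. norm (x k)) {..<n} * L2_set (\<lambda>k. blinfun_apply \<phi> (x k)) {..<n}"
      by (rule L2_set_mult_ineq)
    also have "\<dots> \<le> sqrt A * sqrt (2 * S)"
      unfolding L2_set_def A_def[symmetric] using B \<open>0 \<le> A\<close> by (intro mult_left_mono) auto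
    finally show "norm (\<Sum>k<n. \<theta> k *\<^sub>R norm (x k) *\<^sub>R x k) \<le> sqrt A * sqrt (2 * S)" by (simp add: y_def)
  qed
  finally have "A\<^sup>2 \<le> (C * (sqrt A * sqrt (2 * S)))\<^sup>2"
    using \<open>0 \<le> A\<close> by (intro power_mono)
  also have "\<dots> = A * (2 * C\<^sup>2 * S)"
    using \<open>0 \<le> A\<close> \<open>0 \<le> S\<close> by (simp add: power_mult_distrib)
  finally have "A \<le> 2 * C\<^sup>2 * S"
    using \<open>0 \<le> A\<close> \<open>0 \<le> S\<close> by (cases "A = 0") (auto simp: power2_eq_square[of A])
  then show "(\<Sum>x\<leftarrow>xs. (norm x)\<^sup>2) \<le> 2 * C\<^sup>2 * S" by (simp add: lst A_def)
qed

text \<open>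
  If a constant \<open>C\<close> did bound the sums of the norms, the equivalent inner product would provide orthonormal
  families with \<open>n \<le> C * sqrt (K * n)\<close> for every \<open>n\<close>.
\<close>

lemma not_one_summing:
  assumes inf_dim: "\<not> (\<exists>B :: 'a::real_normed_vector set. finite B \<and> span B = UNIV)" and C: "0 < C"
  obtains n and x :: "nat \<Rightarrow> 'a::real_normed_vector" and M where
    "signed_sums_le n x M" "C * M < (\<Sum>k<n. norm (x k))"
proof (rule ccontr)
  assume "\<not> thesis"
  with that have one: "(\<Sum>k<n. norm (x k)) \<le> C * M"
    if "signed_sums_le n x M" for n and x :: "nat \<Rightarrow> 'a" and M
    using that by (meson not_le)
  define K where "K = 2 * C\<^sup>2"
  have "0 < K" using C by (simp add: K_def)
  have "two_summing TYPE('a) K"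
    unfolding K_def by (rule two_summing_of_one_summing[OF C one])
  then obtain Q :: "'a \<Rightarrow> 'a \<Rightarrow> real" where lin: "\<And>y. linear (\<lambda>x. Q x y)" and sym: "\<And>x y. Q x y = Q y x"
    and Q: "\<And>x. Q x x \<le> (norm x)\<^sup>2" "\<And>x. (norm x)\<^sup>2 \<le> K * Q x x"
    using pietsch \<open>0 < K\<close> by blast
  have pos: "0 < Q x x" if "x \<noteq> 0" for x
    using Q(2)[of x] that \<open>0 < K\<close> by (smt (verit) zero_less_mult_pos zero_less_norm_iff zero_less_power)
  obtain n :: nat where n: "C\<^sup>2 * K < real n" using reals_Archimedean2 by blast
  have "\<exists>u :: nat \<Rightarrow> 'a. \<forall>i<n. \<forall>j<n. Q (u i) (u j) = of_bool (i = j)"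
    by (rule orthonormal_family[OF inf_dim lin sym pos])
  then obtain u where u: "\<And>i j. i < n \<Longrightarrow> j < n \<Longrightarrow> Q (u i) (u j) = of_bool (i = j)" by blast
  have "real n = (\<Sum>k<n. 1)" by simp
  also have "\<dots> \<le> (\<Sum>k<n. norm (u k))"
  proof (rule sum_mono)
    fix k assume "k \<in> {..<n}"
    then have "1\<^sup>2 \<le> (norm (u k))\<^sup>2" using Q(1)[of "u k"] u[of k k] by simp
    then show "1 \<le> norm (u k)" by (rule power2_le_imp_le) simp
  qed
  also have "\<dots> \<le> C * sqrt (K * real n)"
  proof (intro one signed_sums_leI)
    fix \<theta> :: "nat \<Rightarrow> real" assume \<theta>: "\<And>k. k < n \<Longrightarrow> \<bar>\<theta> k\<bar> \<le> 1"
    define y where "y = (\<Sum>k<n. \<theta> k *\<^sub>R u k)"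
    have expand: "Q y z = (\<Sum>k<n. \<theta> k * Q (u k) z)" for z
      unfolding y_def by (simp add: linear_sum[OF lin] linear_scale[OF lin])
    have uy: "Q (u k) y = \<theta> k" if "k < n" for k
    proof -
      have "Q (u k) y = (\<Sum>i<n. \<theta> i * of_bool (i = k))"
        unfolding sym[of "u k"] expand using that u by (intro sum.cong) auto
      then show ?thesis using that by (simp add: of_bool_def if_distrib[of "(*) _"] cong: if_cong)
    qed
    have "(norm y)\<^sup>2 \<le> K * Q y y" by (rule Q(2))
    also have "Q y y = (\<Sum>k<n. (\<theta> k)\<^sup>2)" by (simp add: expand uy power2_eq_square)
    also have "K * \<dots> \<le> K * real n"
      using sum_mono[of "{..<n}" "\<lambda>k. (\<theta> k)\<^sup>2" "\<lambda>_. 1"] \<theta> \<open>0 < K\<close> by (simp add: abs_square_le_1)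
    finally show "norm (\<Sum>k<n. \<theta> k *\<^sub>R u k) \<le> sqrt (K * real n)" by (simp add: real_le_rsqrt y_def)
  qed
  finally have "(real n)\<^sup>2 \<le> (C * sqrt (K * real n))\<^sup>2" by (intro power_mono) auto
  also have "\<dots> = real n * (C\<^sup>2 * K)" using \<open>0 < K\<close> by (simp add: power_mult_distrib)
  finally have "real n \<le> C\<^sup>2 * K"
    using n \<open>0 < K\<close> by (cases "n = 0") (auto simp: power2_eq_square[of "real n"])
  with n show False by simp
qed

text \<open>
  The failure of one constant \<open>R / \<eta>\<close> suffices, because both quantities scale with the family.
\<close>

lemma large_sum_small_range:
  assumes inf_dim: "\<not> (\<exists>B :: 'a::real_normed_vector set. finite B \<and> span B = UNIV)"
    and R: "0 < R" and \<eta>: "0 < \<eta>"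
  obtains n and x :: "nat \<Rightarrow> 'a::real_normed_vector" where
    "signed_sums_le n x \<eta>" "(\<Sum>k<n. norm (x k)) = R"
proof -
  obtain n and x :: "nat \<Rightarrow> 'a" and M where
    M: "signed_sums_le n x M"
    and big: "R / \<eta> * M < (\<Sum>k<n. norm (x k))"
    using not_one_summing[OF inf_dim, of "R / \<eta>"] R \<eta> by (metis divide_pos_pos)
  define \<Sigma> where "\<Sigma> = (\<Sum>k<n. norm (x k))"
  have "0 \<le> M" using signed_sums_leD[OF M, of "\<lambda>_. 0"] by simp
  then have "0 < \<Sigma>" using big R \<eta> by (smt (verit) \<Sigma>_def divide_nonneg_nonneg mult_nonneg_nonneg)
  show ?thesis
  proof (rule that[of n "\<lambda>k. (R / \<Sigma>) *\<^sub>R x k"], rule signed_sums_leI)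
    fix \<theta> :: "nat \<Rightarrow> real" assume "\<And>k. k < n \<Longrightarrow> \<bar>\<theta> k\<bar> \<le> 1"
    then have "(R / \<Sigma>) * norm (\<Sum>k<n. \<theta> k *\<^sub>R x k) \<le> (R / \<Sigma>) * M"
      using signed_sums_leD[OF M] R \<open>0 < \<Sigma>\<close> by (intro mult_left_mono) auto
    also have "\<dots> \<le> \<eta>" using big R \<eta> \<open>0 < \<Sigma>\<close> by (simp add: \<Sigma>_def[symmetric] field_simps)
    finally have "norm ((R / \<Sigma>) *\<^sub>R (\<Sum>k<n. \<theta> k *\<^sub>R x k)) \<le> \<eta>" using R \<open>0 < \<Sigma>\<close> by simp
    then show "norm (\<Sum>k<n. \<theta> k *\<^sub>R (R / \<Sigma>) *\<^sub>R x k) \<le> \<eta>"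
      by (simp add: scaleR_sum_right mult.commute)
  next
    have "(\<Sum>k<n. norm ((R / \<Sigma>) *\<^sub>R x k)) = (R / \<Sigma>) * \<Sigma>"
      using R \<open>0 < \<Sigma>\<close> by (simp add: \<Sigma>_def sum_distrib_left)
    then show "(\<Sum>k<n. norm ((R / \<Sigma>) *\<^sub>R x k)) = R" using \<open>0 < \<Sigma>\<close> by simp
  qed
qed

section \<open>Blocks with small integrals and a steep primitive\<close>

text \<open>
  A block \<open>f\<close> with Pettis integrals \<open>I\<close>. All these integrals have norm at most \<open>\<eta>\<close>, and
  \<open>f\<close> is supported on a set of measure at most \<open>\<delta>\<close>. The primitive \<open>t \<mapsto> I {0..t}\<close> has Lipschitz constant \<open>M\<close>,
  yet every point of the unit interval belongs to a cell \<open>{a..b}\<close>, of length at least \<open>d\<close>, on which the mean slope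
  of the primitive is at least \<open>R\<close>.
\<close>

locale steep_block =
  fixes R \<eta> \<delta> :: real and f :: "real \<Rightarrow> 'a::real_normed_vector" and I :: "real set \<Rightarrow> 'a" and M d :: real
  assumes M_nonneg: "0 \<le> M" and d_pos: "0 < d"
    and simple: "simple_function (lebesgue_on {0..1}) f"
    and outside: "t \<notin> {0..1} \<Longrightarrow> f t = 0"
    and support: "\<exists>A\<in>lmeasurable. measure lebesgue A \<le> \<delta> \<and> (\<forall>t. t \<notin> A \<longrightarrow> f t = 0)"
    and weakly_integrable: "integrable lebesgue (\<lambda>t. blinfun_apply \<phi> (f t))"
    and weak_L1_norm: "(LINT t|lebesgue. \<bar>blinfun_apply \<phi> (f t)\<bar>) \<le> norm \<phi> * \<eta>"
    and pettis: "E \<in> sets lebesgue \<Longrightarrow> has_pettis_integral f (I E) E"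
    and small: "E \<in> sets lebesgue \<Longrightarrow> norm (I E) \<le> \<eta>"
    and lipschitz: "0 \<le> a \<Longrightarrow> a \<le> b \<Longrightarrow> b \<le> 1 \<Longrightarrow> norm (I {0..b} - I {0..a}) \<le> M * (b - a)"
    and steep: "x \<in> {0..1} \<Longrightarrow> \<exists>a b. 0 \<le> a \<and> a \<le> x \<and> x \<le> b \<and> b \<le> 1 \<and> d \<le> b - a \<and>
        R * (b - a) \<le> norm (I {0..b} - I {0..a})"

text \<open>
  Cells may be degenerate, since some of the vectors from which the partition is built may vanish;
  the chosen cell is not.
\<close>

lemma partition_cell:
  fixes a :: "nat \<Rightarrow> real"
  assumes "a 0 \<le> x" "x \<le> a n" "a 0 < a n"
  shows "\<exists>k<n. a k < a (Suc k) \<and> a k \<le> x \<and> x \<le> a (Suc k)"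
  using assms
proof (induction n)
  case (Suc n)
  show ?case
  proof (cases "a n < a (Suc n) \<and> a n \<le> x")
    case True
    with Suc.prems show ?thesis by auto
  next
    case False
    with Suc.prems have "x \<le> a n" "a 0 < a n" by auto
    with Suc show ?thesis using less_SucI by blast
  qed
qed simp

text \<open>
  The value \<open>c k *\<^sub>R x k\<close> on \<open>J k\<close>, the initial part of relative length \<open>\<delta>\<close> of the \<open>k\<close>-th cell, is
  normalised so that the integral over the cell is \<open>x k\<close>. An arbitrary measurable set only scales these
  contributions by factors in \<open>[0, 1]\<close>, which is where the smallness of the sums
  \<open>\<Sum>k<n. \<theta> k *\<^sub>R x k\<close> enters.
\<close>

lemma steep_block_exists:
  fixes R \<eta> \<delta> :: real
  assumes inf_dim: "\<not> (\<exists>B :: 'a::real_normed_vector set. finite B \<and> span B = UNIV)"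
    and R: "0 < R" and \<eta>: "0 < \<eta>" and \<delta>: "0 < \<delta>" "\<delta> \<le> 1"
  shows "\<exists>(f :: real \<Rightarrow> 'a) I M d. steep_block R \<eta> \<delta> f I M d"
proof -
  obtain n and x :: "nat \<Rightarrow> 'a" where small: "signed_sums_le n x \<eta>" and sum: "(\<Sum>k<n. norm (x k)) = R"
    using large_sum_small_range[OF inf_dim R \<eta>] .
  define l where "l k = norm (x k) / R" for k
  define a where "a k = (\<Sum>j<k. l j)" for k
  define J where "J k = {a k<..a k + \<delta> * l k}" for k
  \<comment> \<open>If \<open>x k = 0\<close>, then \<open>J k\<close> is empty and \<open>c k = 0\<close>, which is harmless.\<close>
  define c where "c k = inverse (\<delta> * l k)" for k
  define f where "f t = (\<Sum>k<n. (indicator (J k) t * c k) *\<^sub>R x k)" for t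
  define I where "I E = (\<Sum>k<n. (c k * measure lebesgue (J k \<inter> E)) *\<^sub>R x k)" for E
  have l0: "0 \<le> l k" for k using R by (simp add: l_def)
  have c0: "0 \<le> c k" for k using l0[of k] \<delta> by (simp add: c_def)
  have J_meas [measurable]: "J k \<in> sets lebesgue" for k by (simp add: J_def)
  have Ioc: "{s<..t} \<in> lmeasurable" for s t :: real
    by (rule bounded_set_imp_lmeasurable) auto
  then have J_lm: "J k \<in> lmeasurable" for k by (simp add: J_def)
  have mJ: "measure lebesgue (J k) = \<delta> * l k" for k using l0[of k] \<delta> by (simp add: J_def)
  have cmJ: "(c k * measure lebesgue (J k)) *\<^sub>R x k = x k" for k
    using \<delta> R by (cases "x k = 0") (auto simp: mJ c_def l_def)
  have a0: "a 0 = 0" and a_Suc: "a (Suc k) = a k + l k" for k by (simp_all add: a_def)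
  have an: "a n = 1" using sum R by (simp add: a_def l_def sum_divide_distrib[symmetric])
  have mono: "a j \<le> a k" if "j \<le> k" for j k
    using that l0 unfolding a_def by (intro sum_mono2) auto
  have Jsub: "J k \<subseteq> {a k<..a (Suc k)}" for k
  proof -
    have "\<delta> * l k \<le> 1 * l k" using \<delta> l0 by (intro mult_right_mono) auto
    then show ?thesis by (auto simp: J_def a_Suc)
  qed
  have Jsub01: "J k \<subseteq> {0..1}" if "k < n" for k
    using Jsub[of k] mono[of 0 k] mono[of "Suc k" n] that by (auto simp: a0 an)
  have hbi: "has_bochner_integral lebesgue (\<lambda>t. indicator (J k \<inter> E) t * r) (measure lebesgue (J k \<inter> E) * r)"
    if "E \<in> sets lebesgue" for k E and r :: real
    using fmeasurable_Int_fmeasurable[OF J_lm that, of k]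
    by (intro has_bochner_integral_mult_left has_bochner_integral_real_indicator) (auto simp: fmeasurable_def)
  have \<phi>f: "blinfun_apply \<phi> (f t) = (\<Sum>k<n. indicator (J k) t * (c k * blinfun_apply \<phi> (x k)))"
    for \<phi> :: "'a \<Rightarrow>\<^sub>L real" and t
    by (simp add: f_def blinfun.sum_right blinfun.scaleR_right mult.assoc)
  have int: "has_bochner_integral lebesgue (\<lambda>t. indicator E t * blinfun_apply \<phi> (f t)) (blinfun_apply \<phi> (I E))"
    if "E \<in> sets lebesgue" for \<phi> :: "'a \<Rightarrow>\<^sub>L real" and E
  proof -
    have "has_bochner_integral lebesgue (\<lambda>t. \<Sum>k<n. indicator (J k \<inter> E) t * (c k * blinfun_apply \<phi> (x k)))
        (\<Sum>k<n. measure lebesgue (J k \<inter> E) * (c k * blinfun_apply \<phi> (x k)))"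
      using that by (intro has_bochner_integral_sum hbi)
    moreover have "(\<lambda>t. \<Sum>k<n. indicator (J k \<inter> E) t * (c k * blinfun_apply \<phi> (x k))) =
        (\<lambda>t. indicator E t * blinfun_apply \<phi> (f t))"
      by (rule ext) (simp add: \<phi>f sum_distrib_left indicator_inter_arith mult_ac)
    moreover have "(\<Sum>k<n. measure lebesgue (J k \<inter> E) * (c k * blinfun_apply \<phi> (x k))) = blinfun_apply \<phi> (I E)"
      by (simp add: I_def blinfun.sum_right blinfun.scaleR_right mult_ac)
    ultimately show ?thesis by simp
  qed
  have f0: "f t = 0" if "t \<notin> (\<Union>k<n. J k)" for t
    using that by (auto simp: f_def intro!: sum.neutral)

  have 1: "simple_function (lebesgue_on {0..1}) f"
  proof -
    have "simple_function (lebesgue_on {0..1}) (indicator (J k) :: real \<Rightarrow> real)" if "k < n" for k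
      using Jsub01[OF that] J_meas by (intro simple_function_indicator) (auto simp: sets_restrict_space_iff)
    then show ?thesis
      unfolding f_def[abs_def]
      by (intro simple_function_sum simple_function_compose1[where g="\<lambda>r. (r * c _) *\<^sub>R x _"]) auto
  qed
  have 2: "f t = 0" if "t \<notin> {0..1}" for t
    using that Jsub01 by (intro f0) blast
  have 3: "\<exists>A\<in>lmeasurable. measure lebesgue A \<le> \<delta> \<and> (\<forall>t. t \<notin> A \<longrightarrow> f t = 0)"
  proof (intro bexI conjI allI impI)
    show "(\<Union>k<n. J k) \<in> lmeasurable" using J_lm by (intro fmeasurable.finite_UN) auto
    have "measure lebesgue (\<Union>k<n. J k) \<le> (\<Sum>k<n. measure lebesgue (J k))"
      by (rule measure_UNION_le) auto
    also have "\<dots> = \<delta> * a n" by (simp add: mJ a_def sum_distrib_left)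
    finally show "measure lebesgue (\<Union>k<n. J k) \<le> \<delta>" by (simp add: an)
  qed (rule f0)
  have 4: "integrable lebesgue (\<lambda>t. blinfun_apply \<phi> (f t))"
    "(LINT t|lebesgue. \<bar>blinfun_apply \<phi> (f t)\<bar>) \<le> norm \<phi> * \<eta>" for \<phi> :: "'a \<Rightarrow>\<^sub>L real"
  proof -
    show intf: "integrable lebesgue (\<lambda>t. blinfun_apply \<phi> (f t))"
      using int[of UNIV \<phi>] by (simp add: has_bochner_integral_iff)
    have hb: "has_bochner_integral lebesgue (\<lambda>t. \<Sum>k<n. indicator (J k \<inter> UNIV) t * (c k * \<bar>blinfun_apply \<phi> (x k)\<bar>))
        (\<Sum>k<n. measure lebesgue (J k \<inter> UNIV) * (c k * \<bar>blinfun_apply \<phi> (x k)\<bar>))"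
      by (intro has_bochner_integral_sum hbi) simp
    have "(LINT t|lebesgue. \<bar>blinfun_apply \<phi> (f t)\<bar>)
        \<le> (LINT t|lebesgue. (\<Sum>k<n. indicator (J k \<inter> UNIV) t * (c k * \<bar>blinfun_apply \<phi> (x k)\<bar>)))"
    proof (rule integral_mono)
      show "\<bar>blinfun_apply \<phi> (f t)\<bar> \<le> (\<Sum>k<n. indicator (J k \<inter> UNIV) t * (c k * \<bar>blinfun_apply \<phi> (x k)\<bar>))" for t
        unfolding \<phi>f using c0 by (intro order_trans[OF sum_abs] sum_mono) (simp add: abs_mult)
    qed (use intf hb in \<open>auto simp: has_bochner_integral_iff\<close>)
    also have "\<dots> = (\<Sum>k<n. measure lebesgue (J k \<inter> UNIV) * (c k * \<bar>blinfun_apply \<phi> (x k)\<bar>))"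
      using hb by (simp only: has_bochner_integral_iff)
    also have "\<dots> = (\<Sum>k<n. \<bar>blinfun_apply \<phi> (x k)\<bar>)"
    proof (rule sum.cong[OF refl])
      fix k
      have "measure lebesgue (J k \<inter> UNIV) * (c k * \<bar>blinfun_apply \<phi> (x k)\<bar>)
          = \<bar>blinfun_apply \<phi> ((c k * measure lebesgue (J k)) *\<^sub>R x k)\<bar>"
        using c0[of k] by (simp add: blinfun.scaleR_right abs_mult)
      then show "measure lebesgue (J k \<inter> UNIV) * (c k * \<bar>blinfun_apply \<phi> (x k)\<bar>) = \<bar>blinfun_apply \<phi> (x k)\<bar>"
        by (simp only: cmJ)
    qed
    also have "\<dots> = blinfun_apply \<phi> (\<Sum>k<n. sgn (blinfun_apply \<phi> (x k)) *\<^sub>R x k)"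
      by (simp add: blinfun.sum_right blinfun.scaleR_right abs_sgn mult.commute)
    also have "\<dots> \<le> norm \<phi> * norm (\<Sum>k<n. sgn (blinfun_apply \<phi> (x k)) *\<^sub>R x k)"
      using norm_blinfun[of \<phi>] by (simp add: abs_le_iff)
    also have "\<dots> \<le> norm \<phi> * \<eta>"
      by (intro mult_left_mono signed_sums_leD[OF small]) (auto simp: sgn_real_def)
    finally show "(LINT t|lebesgue. \<bar>blinfun_apply \<phi> (f t)\<bar>) \<le> norm \<phi> * \<eta>" .
  qed
  have 5: "has_pettis_integral f (I E) E" if "E \<in> sets lebesgue" for E
    using int[OF that] by (simp add: has_pettis_integral_def set_lebesgue_integral_def has_bochner_integral_iff)
  have 6: "norm (I E) \<le> \<eta>" if "E \<in> sets lebesgue" for E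
    unfolding I_def
  proof (rule signed_sums_leD[OF small])
    fix k
    have "c k * measure lebesgue (J k \<inter> E) \<le> c k * measure lebesgue (J k)"
      using c0 J_lm that by (intro mult_left_mono measure_mono_fmeasurable) auto
    also have "\<dots> \<le> 1" using \<delta> by (cases "l k = 0") (auto simp: mJ c_def field_simps)
    finally show "\<bar>c k * measure lebesgue (J k \<inter> E)\<bar> \<le> 1" using c0[of k] by simp
  qed
  have diff: "I {0..t} - I {0..s} = (\<Sum>k<n. (c k * measure lebesgue (J k \<inter> {s<..t})) *\<^sub>R x k)"
    if "0 \<le> s" "s \<le> t" for s t
  proof -
    have "measure lebesgue (J k \<inter> {0..t}) = measure lebesgue (J k \<inter> {0..s}) + measure lebesgue (J k \<inter> {s<..t})" for k
    proof -
      have "J k \<inter> {0..t} = (J k \<inter> {0..s}) \<union> (J k \<inter> {s<..t})" using that by auto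
      moreover have "measure lebesgue ((J k \<inter> {0..s}) \<union> (J k \<inter> {s<..t})) =
          measure lebesgue (J k \<inter> {0..s}) + measure lebesgue (J k \<inter> {s<..t})"
        using fmeasurableD2[OF fmeasurable_Int_fmeasurable[OF J_lm]]
        by (intro measure_Union) (auto simp del: emeasure_completion)
      ultimately show ?thesis by simp
    qed
    then show ?thesis
      by (simp add: I_def sum_subtractf[symmetric] scaleR_left_diff_distrib[symmetric] algebra_simps)
  qed
  define M where "M = (\<Sum>k<n. c k * norm (x k))"
  have 7: "norm (I {0..t} - I {0..s}) \<le> M * (t - s)" if "0 \<le> s" "s \<le> t" for s t
  proof -
    have "norm (I {0..t} - I {0..s}) \<le> (\<Sum>k<n. c k * norm (x k) * (t - s))"
      unfolding diff[OF that]
    proof (rule sum_norm_le)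
      fix k
      have "measure lebesgue (J k \<inter> {s<..t}) \<le> measure lebesgue {s<..t}"
        using Ioc by (intro measure_mono_fmeasurable) auto
      also have "\<dots> = t - s" using that by simp
      finally have "c k * norm (x k) * measure lebesgue (J k \<inter> {s<..t}) \<le> c k * norm (x k) * (t - s)"
        using c0[of k] by (intro mult_left_mono) auto
      then show "norm ((c k * measure lebesgue (J k \<inter> {s<..t})) *\<^sub>R x k) \<le> c k * norm (x k) * (t - s)"
        using c0[of k] by (simp add: mult_ac)
    qed
    then show ?thesis by (simp add: M_def sum_distrib_right)
  qed
  define d where "d = Min (l ` {k. k < n \<and> 0 < l k})"
  have d_le: "d \<le> l k" if "k < n" "0 < l k" for k
    unfolding d_def using that by (intro Min_le) auto
  have cell: "\<exists>k<n. a k < a (Suc k) \<and> a k \<le> t \<and> t \<le> a (Suc k)" if "t \<in> {0..1}" for t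
    using that by (intro partition_cell) (auto simp: a0 an)
  have "0 < d"
    unfolding d_def using cell[of 0] by (subst Min_gr_iff) (auto simp: a_Suc)
  have 8: "\<exists>s t. 0 \<le> s \<and> s \<le> u \<and> u \<le> t \<and> t \<le> 1 \<and> d \<le> t - s \<and> R * (t - s) \<le> norm (I {0..t} - I {0..s})"
    if u: "u \<in> {0..1}" for u
  proof -
    obtain k where k: "k < n" "a k < a (Suc k)" "a k \<le> u" "u \<le> a (Suc k)" using cell[OF u] by blast
    have "(c j * measure lebesgue (J j \<inter> {a k<..a (Suc k)})) *\<^sub>R x j = (if j = k then x k else 0)" for j
    proof (cases j k rule: linorder_cases)
      case less
      then have "J j \<inter> {a k<..a (Suc k)} = {}" using Jsub[of j] mono[of "Suc j" k] by fastforce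
      then show ?thesis using less by simp
    next
      case equal
      then have "J j \<inter> {a k<..a (Suc k)} = J j" using Jsub[of j] by auto
      then show ?thesis using cmJ[of j] equal by simp
    next
      case greater
      then have "J j \<inter> {a k<..a (Suc k)} = {}" using Jsub[of j] mono[of "Suc k" j] by fastforce
      then show ?thesis using greater by simp
    qed
    then have "I {0..a (Suc k)} - I {0..a k} = x k"
      using diff[of "a k" "a (Suc k)"] mono[of 0 k] k by (simp add: a0)
    moreover have "norm (x k) = R * (a (Suc k) - a k)" using R by (simp add: a_Suc l_def)
    ultimately show ?thesis
      using k mono[of 0 k] mono[of "Suc k" n] d_le[of k]
      by (intro exI[of _ "a k"] exI[of _ "a (Suc k)"]) (auto simp: a0 an a_Suc)
  qed
  have "0 \<le> M" unfolding M_def using c0 by (intro sum_nonneg) auto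
  have "steep_block R \<eta> \<delta> f I M d"
    using \<open>0 \<le> M\<close> \<open>0 < d\<close> 1 2 3 4 5 6 7 8 by (rule steep_block.intro)
  then show ?thesis by blast
qed

section \<open>A gliding hump\<close>

text \<open>
  The choice of block \<open>i\<close> depends on the Lipschitz constants and the shortest cells of all earlier blocks,
  hence the recursion over the whole history.
\<close>

lemma steep_blocks_exist:
  assumes inf_dim: "\<not> (\<exists>B :: 'a::real_normed_vector set. finite B \<and> span B = UNIV)"
  shows "\<exists>(f :: nat \<Rightarrow> real \<Rightarrow> 'a) I M d \<eta>. \<forall>i.
    steep_block (real (Suc i) * (1 + (\<Sum>l<i. M l))) (\<eta> i) ((1/2)^i) (f i) (I i) (M i) (d i) \<and>
    0 < \<eta> i \<and> \<eta> i \<le> (1/2)^(i+2) \<and> (\<forall>l<i. \<eta> i \<le> (1/2)^(i+2) * d l)"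
proof -
  define P :: "(nat \<Rightarrow> (real \<Rightarrow> 'a) \<times> (real set \<Rightarrow> 'a) \<times> real \<times> real \<times> real) \<Rightarrow> nat \<Rightarrow>
      (real \<Rightarrow> 'a) \<times> (real set \<Rightarrow> 'a) \<times> real \<times> real \<times> real \<Rightarrow> bool" where
    "P F i r = (case r of (f, I, M, d, \<eta>) \<Rightarrow>
      steep_block (real (Suc i) * (1 + (\<Sum>l<i. fst (snd (snd (F l)))))) \<eta> ((1/2)^i) f I M d \<and>
      0 < \<eta> \<and> \<eta> \<le> (1/2)^(i+2) \<and> (\<forall>l<i. \<eta> \<le> (1/2)^(i+2) * fst (snd (snd (snd (F l))))))" for F i r
  have "\<exists>F. \<forall>i. P F i (F i)"
  proof (rule dependent_wellorder_choice)
    show "P F i r = P G i r" if "\<And>j. j < i \<Longrightarrow> F j = G j" for F G i r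
    proof -
      have "(\<Sum>l<i. fst (snd (snd (F l)))) = (\<Sum>l<i. fst (snd (snd (G l))))"
        using that by (intro sum.cong) auto
      then show ?thesis using that by (simp add: P_def)
    qed
    fix i F assume IH: "\<And>j. j < i \<Longrightarrow> P F j (F j)"
    have M0: "0 \<le> fst (snd (snd (F j)))" and d0: "0 < fst (snd (snd (snd (F j))))" if "j < i" for j
    proof -
      have "\<exists>R \<eta> \<delta>. steep_block R \<eta> \<delta> (fst (F j)) (fst (snd (F j))) (fst (snd (snd (F j)))) (fst (snd (snd (snd (F j)))))"
        using IH[OF that] unfolding P_def case_prod_beta by blast
      then obtain R \<eta> \<delta> where
        b: "steep_block R \<eta> \<delta> (fst (F j)) (fst (snd (F j))) (fst (snd (snd (F j)))) (fst (snd (snd (snd (F j)))))"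
        by blast
      show "0 \<le> fst (snd (snd (F j)))" by (rule steep_block.M_nonneg[OF b])
      show "0 < fst (snd (snd (snd (F j))))" by (rule steep_block.d_pos[OF b])
    qed
    \<comment> \<open>The value \<open>1\<close> keeps the set nonempty for the first block and the resulting bounds on the integrals summable.\<close>
    define D where "D = Min (insert 1 ((\<lambda>l. fst (snd (snd (snd (F l))))) ` {..<i}))"
    have "0 < D" unfolding D_def using d0 by (subst Min_gr_iff) auto
    have "D \<le> 1" unfolding D_def by (intro Min_le) auto
    have Dl: "D \<le> fst (snd (snd (snd (F l))))" if "l < i" for l
      unfolding D_def using that by (intro Min_le) auto
    have R: "0 < real (Suc i) * (1 + (\<Sum>l<i. fst (snd (snd (F l)))))"
      using M0 by (intro mult_pos_pos add_pos_nonneg sum_nonneg) auto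
    have \<eta>: "0 < (1/2)^(i+2) * D" using \<open>0 < D\<close> by simp
    have \<delta>: "0 < (1/2 :: real)^i" "(1/2 :: real)^i \<le> 1" by (simp_all add: power_le_one)
    obtain f :: "real \<Rightarrow> 'a" and I M d where
      "steep_block (real (Suc i) * (1 + (\<Sum>l<i. fst (snd (snd (F l)))))) ((1/2)^(i+2) * D) ((1/2)^i) f I M d"
      using steep_block_exists[OF inf_dim R \<eta> \<delta>] by blast
    then have "P F i (f, I, M, d, (1/2)^(i+2) * D)"
      using \<open>0 < D\<close> \<open>D \<le> 1\<close> Dl by (simp add: P_def)
    then show "\<exists>r. P F i r" by blast
  qed
  then obtain F where F: "\<And>i. P F i (F i)" by blast
  show ?thesis
    by (intro exI[of _ "\<lambda>i. fst (F i)"] exI[of _ "\<lambda>i. fst (snd (F i))"] exI[of _ "\<lambda>i. fst (snd (snd (F i)))"]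
        exI[of _ "\<lambda>i. fst (snd (snd (snd (F i))))"] exI[of _ "\<lambda>i. snd (snd (snd (snd (F i))))"])
      (use F in \<open>simp add: P_def case_prod_beta\<close>)
qed

text \<open>
  A sequence of blocks in which, seen on a cell of \<open>h i\<close>, the earlier blocks are flat and the later ones
  are negligible. Since at every point only finitely many blocks are nonzero, all series of blocks converge pointwise.
\<close>

locale steep_sequence =
  fixes h :: "nat \<Rightarrow> real \<Rightarrow> 'a::banach" and I :: "nat \<Rightarrow> real set \<Rightarrow> 'a" and M d \<eta> :: "nat \<Rightarrow> real"
  assumes simple: "simple_function (lebesgue_on {0..1}) (h i)"
    and outside: "t \<notin> {0..1} \<Longrightarrow> h i t = 0"
    and point_finite: "finite {i. h i t \<noteq> 0}"
    and weakly_integrable: "integrable lebesgue (\<lambda>t. blinfun_apply \<phi> (h i t))"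
    and weak_L1_norm: "(LINT t|lebesgue. \<bar>blinfun_apply \<phi> (h i t)\<bar>) \<le> norm \<phi> * \<eta> i"
    and pettis: "E \<in> sets lebesgue \<Longrightarrow> has_pettis_integral (h i) (I i E) E"
    and small: "E \<in> sets lebesgue \<Longrightarrow> norm (I i E) \<le> \<eta> i"
    and M_nonneg: "0 \<le> M i"
    and lipschitz: "0 \<le> a \<Longrightarrow> a \<le> b \<Longrightarrow> b \<le> 1 \<Longrightarrow> norm (I i {0..b} - I i {0..a}) \<le> M i * (b - a)"
    and d_pos: "0 < d i"
    and steep: "x \<in> {0..1} \<Longrightarrow> \<exists>a b. 0 \<le> a \<and> a \<le> x \<and> x \<le> b \<and> b \<le> 1 \<and> d i \<le> b - a \<and>
        real (Suc i) * (1 + (\<Sum>l<i. M l)) * (b - a) \<le> norm (I i {0..b} - I i {0..a})"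
    and summable_\<eta>: "summable \<eta>"
    and tail_small: "2 * (\<Sum>l. \<eta> (l + Suc i)) \<le> d i"

text \<open>
  The blocks are modified on the null set where infinitely many of them are nonzero. This changes none of
  their integrals.
\<close>

lemma steep_sequence_exists:
  assumes inf_dim: "\<not> (\<exists>B :: 'a::banach set. finite B \<and> span B = UNIV)"
  shows "\<exists>(h :: nat \<Rightarrow> real \<Rightarrow> 'a) I M d \<eta>. steep_sequence h I M d \<eta>"
proof -
  obtain f :: "nat \<Rightarrow> real \<Rightarrow> 'a" and I M d \<eta> where *: "\<forall>i.
    steep_block (real (Suc i) * (1 + (\<Sum>l<i. M l))) (\<eta> i) ((1/2)^i) (f i) (I i) (M i) (d i) \<and>
    0 < \<eta> i \<and> \<eta> i \<le> (1/2)^(i+2) \<and> (\<forall>l<i. \<eta> i \<le> (1/2)^(i+2) * d l)"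
    using steep_blocks_exist[OF inf_dim] by blast
  have block: "steep_block (real (Suc i) * (1 + (\<Sum>l<i. M l))) (\<eta> i) ((1/2)^i) (f i) (I i) (M i) (d i)" for i
    using * by blast
  have \<eta>0: "0 \<le> \<eta> i" and \<eta>_le: "\<eta> i \<le> (1/2)^(i+2)" and \<eta>_d: "l < i \<Longrightarrow> \<eta> i \<le> (1/2)^(i+2) * d l" for i l
    using *[rule_format, of i] by auto
  have "\<forall>i. \<exists>A. A \<in> lmeasurable \<and> measure lebesgue A \<le> (1/2)^i \<and> (\<forall>t. t \<notin> A \<longrightarrow> f i t = 0)"
    using steep_block.support[OF block] by blast
  then obtain A where A: "\<And>i. A i \<in> lmeasurable" "\<And>i. measure lebesgue (A i) \<le> (1/2)^i"
    "\<And>i t. t \<notin> A i \<Longrightarrow> f i t = 0" by metis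
  define N where "N = {t. finite {i. f i t \<noteq> 0}}"
  have AE_N: "AE t in lebesgue. t \<in> N"
  proof -
    have "summable (\<lambda>i. measure lebesgue (A i))"
      using A(2) by (intro summable_comparison_test'[OF summable_geometric[of "1/2 :: real"]]) auto
    then have "AE t in lebesgue. \<forall>\<^sub>F i in sequentially. t \<in> space lebesgue - A i"
      using A(1) by (intro borel_cantelli_AE1) (auto simp: fmeasurable_def simp del: emeasure_completion)
    then show ?thesis
    proof (rule AE_mp, intro AE_I2 impI)
      fix t assume "\<forall>\<^sub>F i in sequentially. t \<in> space lebesgue - A i"
      then obtain n where "\<And>i. n \<le> i \<Longrightarrow> t \<notin> A i" by (auto simp: eventually_sequentially)
      then have "{i. f i t \<noteq> 0} \<subseteq> {..<n}" using A(3) by (force simp: not_le[symmetric])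
      then show "t \<in> N" unfolding N_def using finite_subset by blast
    qed
  qed
  then have N_sets [measurable]: "N \<in> sets lebesgue"
    using complete_measure.in_sets_AE[OF completion.complete_measure_axioms, of UNIV N lborel] by simp
  define h where "h i t = indicator N t *\<^sub>R f i t" for i t
  have h_eq_0: "h i t = 0" if "f i t = 0" for i t using that by (simp add: h_def)
  have AE_eq: "AE t in lebesgue. h i t = f i t" for i
    using AE_N by eventually_elim (simp add: h_def)
  show ?thesis
  proof (intro exI)
    show "steep_sequence h I M d \<eta>"
    proof
      fix i
      have b: "simple_function (lebesgue_on {0..1}) (f i)" "\<And>t. t \<notin> {0..1} \<Longrightarrow> f i t = 0"
        using steep_block.simple[OF block] steep_block.outside[OF block] by blast+
      have "h i = (\<lambda>t. indicator (N \<inter> {0..1}) t *\<^sub>R f i t)"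
        using b(2) by (auto simp: h_def indicator_def fun_eq_iff)
      moreover have "simple_function (lebesgue_on {0..1}) (indicator (N \<inter> {0..1}) :: real \<Rightarrow> real)"
        by (intro simple_function_indicator) (auto simp: sets_restrict_space_iff)
      ultimately show "simple_function (lebesgue_on {0..1}) (h i)"
        using simple_function_compose2[OF _ b(1), of _ "(*\<^sub>R)"] by simp
      show "h i t = 0" if "t \<notin> {0..1}" for t using b(2)[OF that] by (rule h_eq_0)
    next
      fix t
      show "finite {i. h i t \<noteq> 0}" by (cases "t \<in> N") (auto simp: h_def N_def)
    next
      fix \<phi> :: "'a \<Rightarrow>\<^sub>L real" and i
      have b: "integrable lebesgue (\<lambda>t. blinfun_apply \<phi> (f i t))"
        "(LINT t|lebesgue. \<bar>blinfun_apply \<phi> (f i t)\<bar>) \<le> norm \<phi> * \<eta> i"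
        by (rule steep_block.weakly_integrable[OF block], rule steep_block.weak_L1_norm[OF block])
      have m [measurable]: "(\<lambda>t. blinfun_apply \<phi> (f i t)) \<in> borel_measurable lebesgue" using b(1) by auto
      have [measurable]: "(\<lambda>t. blinfun_apply \<phi> (h i t)) \<in> borel_measurable lebesgue"
        unfolding h_def blinfun.scaleR_right by measurable
      show "integrable lebesgue (\<lambda>t. blinfun_apply \<phi> (h i t))"
        using b(1) by (rule integrable_cong_AE_imp) (use AE_eq[of i] in auto)
      have "(LINT t|lebesgue. \<bar>blinfun_apply \<phi> (h i t)\<bar>) = (LINT t|lebesgue. \<bar>blinfun_apply \<phi> (f i t)\<bar>)"
        by (rule integral_cong_AE) (use AE_eq[of i] in auto)
      with b(2) show "(LINT t|lebesgue. \<bar>blinfun_apply \<phi> (h i t)\<bar>) \<le> norm \<phi> * \<eta> i" by simp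
    next
      fix E :: "real set" and i assume E [measurable]: "E \<in> sets lebesgue"
      show "norm (I i E) \<le> \<eta> i" using E by (rule steep_block.small[OF block])
      have p: "has_pettis_integral (f i) (I i E) E" using E by (rule steep_block.pettis[OF block])
      show "has_pettis_integral (h i) (I i E) E"
        unfolding has_pettis_integral_def
      proof
        fix \<phi> :: "'a \<Rightarrow>\<^sub>L real"
        have "integrable lebesgue (\<lambda>t. blinfun_apply \<phi> (f i t))"
          by (rule steep_block.weakly_integrable[OF block])
        then have m [measurable]: "(\<lambda>t. blinfun_apply \<phi> (f i t)) \<in> borel_measurable lebesgue" by auto
        have [measurable]: "(\<lambda>t. blinfun_apply \<phi> (h i t)) \<in> borel_measurable lebesgue"
          unfolding h_def blinfun.scaleR_right by measurable
        have "(LINT t:E|lebesgue. blinfun_apply \<phi> (h i t)) = (LINT t:E|lebesgue. blinfun_apply \<phi> (f i t))"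
          unfolding set_lebesgue_integral_def by (rule integral_cong_AE) (use AE_eq[of i] in auto)
        with p show "blinfun_apply \<phi> (I i E) = (LINT t:E|lebesgue. blinfun_apply \<phi> (h i t))"
          by (simp add: has_pettis_integral_def)
      qed
    next
      show "0 \<le> M i" "0 < d i" for i
        by (rule steep_block.M_nonneg[OF block], rule steep_block.d_pos[OF block])
      show "norm (I i {0..b} - I i {0..a}) \<le> M i * (b - a)" if "0 \<le> a" "a \<le> b" "b \<le> 1" for i a b
        using that by (rule steep_block.lipschitz[OF block])
      show "\<exists>a b. 0 \<le> a \<and> a \<le> x \<and> x \<le> b \<and> b \<le> 1 \<and> d i \<le> b - a \<and>
        real (Suc i) * (1 + (\<Sum>l<i. M l)) * (b - a) \<le> norm (I i {0..b} - I i {0..a})"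
        if "x \<in> {0..1}" for x i
        using that by (rule steep_block.steep[OF block])
    next
      have sg: "summable (\<lambda>i. (1/2 :: real) ^ i)" by (simp add: summable_geometric)
      show sum\<eta>: "summable \<eta>"
      proof (rule summable_comparison_test'[OF sg])
        fix i
        have "(1/2 :: real) ^ (i + 2) \<le> (1/2) ^ i" by (rule power_decreasing) auto
        then show "norm (\<eta> i) \<le> (1/2) ^ i" using \<eta>0[of i] \<eta>_le[of i] by simp
      qed
      fix i
      have "0 < d i" by (rule steep_block.d_pos[OF block])
      have "(\<Sum>l. \<eta> (l + Suc i)) \<le> (\<Sum>l. (1/2)^l * (d i / 4))"
      proof (rule suminf_le)
        show "summable (\<lambda>l. \<eta> (l + Suc i))" using sum\<eta> by (rule summable_ignore_initial_segment)
        show "summable (\<lambda>l. (1/2)^l * (d i / 4))" using sg by (rule summable_mult2)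
        fix l
        have "\<eta> (l + Suc i) \<le> (1/2)^(l + Suc i + 2) * d i" by (rule \<eta>_d) simp
        also have "(1/2 :: real)^(l + Suc i + 2) \<le> (1/2)^(l+2)" by (rule power_decreasing) auto
        finally show "\<eta> (l + Suc i) \<le> (1/2)^l * (d i / 4)" using \<open>0 < d i\<close> by simp
      qed
      also have "\<dots> = d i / 2"
        using suminf_mult2[OF sg, of "d i / 4"] suminf_geometric[of "1/2 :: real"] by simp
      finally show "2 * (\<Sum>l. \<eta> (l + Suc i)) \<le> d i" by simp
    qed
  qed
qed

text \<open>
  Uniqueness of the Pettis integral, by Hahn--Banach.
\<close>

lemma pettis_integral_eqI:
  assumes "has_pettis_integral f v E"
  shows "pettis_integral E f = v"
proof -
  have "has_pettis_integral f (pettis_integral E f) E"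
    unfolding pettis_integral_def using assms by (rule someI)
  then show ?thesis
    using assms functionals_separate[of "pettis_integral E f" v] unfolding has_pettis_integral_def by simp
qed

context steep_sequence
begin

definition combination :: "(nat \<Rightarrow> real) \<Rightarrow> real \<Rightarrow> 'a" where
  "combination \<beta> t = (\<Sum>i. \<beta> i *\<^sub>R h i t)"

lemma combination_finite_sum:
  "combination \<beta> t = (\<Sum>i | h i t \<noteq> 0. \<beta> i *\<^sub>R h i t)"
  unfolding combination_def using point_finite by (intro suminf_finite) auto

lemma summable_combination: "summable (\<lambda>i. \<beta> i *\<^sub>R h i t)"
  using point_finite by (rule summable_finite) auto

definition combination_integral :: "(nat \<Rightarrow> real) \<Rightarrow> real set \<Rightarrow> 'a" where
  "combination_integral \<beta> E = (\<Sum>i. \<beta> i *\<^sub>R I i E)"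

lemma eta_nonneg: "0 \<le> \<eta> i"
  using small[of "{}" i] norm_ge_zero[of "I i {}"] by (smt (verit) sets.empty_sets)

lemma norm_scaled_le:
  assumes "\<bar>b\<bar> \<le> K" "E \<in> sets lebesgue"
  shows "norm (b *\<^sub>R I i E) \<le> K * \<eta> i"
  using assms small[of E i] eta_nonneg[of i] by (simp add: mult_mono)

lemma summable_combination_integral:
  assumes \<beta>: "\<forall>i. \<bar>\<beta> i\<bar> \<le> K" and E: "E \<in> sets lebesgue"
  shows "summable (\<lambda>i. \<beta> i *\<^sub>R I i E)"
  by (rule summable_comparison_test'[OF summable_mult[OF summable_\<eta>, of K]])
     (use norm_scaled_le[OF \<beta>[rule_format] E] in auto)

lemma norm_combination_integral_le:
  assumes \<beta>: "\<forall>i. \<bar>\<beta> i\<bar> \<le> K" and E: "E \<in> sets lebesgue"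
  shows "norm (combination_integral \<beta> E) \<le> K * (\<Sum>i. \<eta> i)"
proof -
  have "norm (combination_integral \<beta> E) \<le> (\<Sum>i. K * \<eta> i)"
    unfolding combination_integral_def by (intro norm_suminf_le norm_scaled_le \<beta>[rule_format] E summable_mult summable_\<eta>)
  also have "\<dots> = K * (\<Sum>i. \<eta> i)" by (rule suminf_mult[OF summable_\<eta>])
  finally show ?thesis .
qed

text \<open>
  Scalar integrals of the series may be taken term by term: the scalar \<open>L\<^sub>1\<close>-norm of the \<open>i\<close>-th
  term is at most \<open>K * norm \<phi> * \<eta> i\<close>, which is summable.
\<close>

lemma has_bochner_integral_combination:
  assumes \<beta>: "\<forall>i. \<bar>\<beta> i\<bar> \<le> K" and E [measurable]: "E \<in> sets lebesgue"
  shows "has_bochner_integral lebesgue (\<lambda>t. indicator E t * blinfun_apply \<phi> (combination \<beta> t))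
    (blinfun_apply (\<phi> :: 'a \<Rightarrow>\<^sub>L real) (combination_integral \<beta> E))"
proof -
  have K: "0 \<le> K" using \<beta>[rule_format, of 0] by simp
  define g where "g i t = indicator E t * (\<beta> i * blinfun_apply \<phi> (h i t))" for i t
  have m [measurable]: "(\<lambda>t. blinfun_apply \<phi> (h i t)) \<in> borel_measurable lebesgue" for i
    using weakly_integrable by (rule borel_measurable_integrable)
  have int: "integrable lebesgue (g i)" for i
    unfolding g_def using integrable_mult_indicator[OF E, of "\<lambda>t. \<beta> i * blinfun_apply \<phi> (h i t)"] weakly_integrable
    by simp
  have point: "g i t = 0" if "i \<notin> {i. h i t \<noteq> 0}" for i t using that by (simp add: g_def)
  have s1: "AE t in lebesgue. summable (\<lambda>i. norm (g i t))"
    by (intro AE_I2 summable_finite[OF point_finite]) (use point in auto)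
  have s2: "summable (\<lambda>i. LINT t|lebesgue. norm (g i t))"
  proof (rule summable_comparison_test')
    show "summable (\<lambda>i. K * (norm \<phi> * \<eta> i))" by (intro summable_mult summable_\<eta>)
    fix i
    have "(LINT t|lebesgue. norm (g i t)) \<le> (LINT t|lebesgue. K * \<bar>blinfun_apply \<phi> (h i t)\<bar>)"
    proof (rule integral_mono)
      show "norm (g i t) \<le> K * \<bar>blinfun_apply \<phi> (h i t)\<bar>" for t
        using \<beta>[rule_format, of i] K by (auto simp: g_def abs_mult indicator_def intro!: mult_right_mono)
    qed (use int weakly_integrable in auto)
    also have "\<dots> \<le> K * (norm \<phi> * \<eta> i)"
      using K weak_L1_norm[of \<phi> i] by (simp add: mult_left_mono)
    finally show "norm (LINT t|lebesgue. norm (g i t)) \<le> K * (norm \<phi> * \<eta> i)" by simp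
  qed
  have val: "(\<Sum>i. g i t) = indicator E t * blinfun_apply \<phi> (combination \<beta> t)" for t
  proof -
    have "blinfun_apply \<phi> (combination \<beta> t) = (\<Sum>i | h i t \<noteq> 0. \<beta> i * blinfun_apply \<phi> (h i t))"
      by (simp add: combination_finite_sum blinfun.sum_right blinfun.scaleR_right)
    moreover have "(\<Sum>i. g i t) = (\<Sum>i | h i t \<noteq> 0. g i t)"
      using point_finite point by (intro suminf_finite) auto
    ultimately show ?thesis by (simp add: g_def sum_distrib_left)
  qed
  have "integral\<^sup>L lebesgue (g i) = blinfun_apply \<phi> (\<beta> i *\<^sub>R I i E)" for i
  proof -
    have "g i = (\<lambda>t. \<beta> i * (indicator E t *\<^sub>R blinfun_apply \<phi> (h i t)))" by (auto simp: g_def)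
    then have "integral\<^sup>L lebesgue (g i) = \<beta> i * (LINT t:E|lebesgue. blinfun_apply \<phi> (h i t))"
      by (simp only: integral_mult_right_zero set_lebesgue_integral_def)
    then show ?thesis
      using pettis[OF E, of i] by (simp add: has_pettis_integral_def blinfun.scaleR_right)
  qed
  then have "(\<Sum>i. integral\<^sup>L lebesgue (g i)) = blinfun_apply \<phi> (combination_integral \<beta> E)"
    unfolding combination_integral_def
    using bounded_linear.suminf[OF blinfun.bounded_linear_right summable_combination_integral[OF \<beta> E], of \<phi>] by simp
  then show ?thesis
    using integrable_suminf[OF int s1 s2] integral_suminf[OF int s1 s2]
    by (simp add: has_bochner_integral_iff val)
qed

lemma has_pettis_integral_combination:
  assumes "\<forall>i. \<bar>\<beta> i\<bar> \<le> K" "E \<in> sets lebesgue"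
  shows "has_pettis_integral (combination \<beta>) (combination_integral \<beta> E) E"
  using has_bochner_integral_combination[OF assms]
  by (simp add: has_pettis_integral_def set_lebesgue_integral_def has_bochner_integral_iff)

lemma pettis_primitive_combination:
  assumes "\<forall>i. \<bar>\<beta> i\<bar> \<le> K"
  shows "pettis_primitive (combination \<beta>) t = combination_integral \<beta> {0..t}"
  unfolding pettis_primitive_def
  by (intro pettis_integral_eqI has_pettis_integral_combination[OF assms]) auto

lemma combination_pettis_function:
  assumes \<beta>: "\<forall>i. \<bar>\<beta> i\<bar> \<le> K"
  shows "combination \<beta> \<in> pettis_functions"
proof -
  have "strongly_measurable (combination \<beta>)"
    unfolding strongly_measurable_def
  proof (intro exI conjI allI AE_I2)
    show "simple_function (lebesgue_on {0..1}) (\<lambda>t. \<Sum>i<n. \<beta> i *\<^sub>R h i t)" for n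
      by (intro simple_function_sum simple_function_compose1[where g="\<lambda>v. \<beta> _ *\<^sub>R v"] simple)
    show "(\<lambda>n. \<Sum>i<n. \<beta> i *\<^sub>R h i t) \<longlonglongrightarrow> combination \<beta> t" for t
      unfolding combination_def by (intro summable_LIMSEQ summable_combination)
  qed
  moreover have "integrable (lebesgue_on {0..1}) (\<lambda>t. blinfun_apply \<phi> (combination \<beta> t))" for \<phi> :: "'a \<Rightarrow>\<^sub>L real"
    using has_bochner_integral_combination[OF \<beta>, of "{0..1}" \<phi>]
    by (simp add: integrable_restrict_space has_bochner_integral_iff)
  ultimately show ?thesis
    using has_pettis_integral_combination[OF \<beta>] outside
    by (auto simp: pettis_functions_def pettis_integrable_def combination_def)
qed

text \<open>
  On a cell of block \<open>i\<close> the increment of the primitive is the contribution of block \<open>i\<close>, of size at least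
  \<open>(i + 1) * c * B * (b - a)\<close> with \<open>B = 1 + (\<Sum>l<i. M l)\<close>, up to two errors: the earlier blocks contribute at most
  \<open>K * (\<Sum>l<i. M l) * (b - a)\<close> and the later ones at most \<open>K * d i \<le> K * (b - a)\<close>. Together the errors are at
  most \<open>K * B * (b - a)\<close>.
\<close>

lemma cell_increment:
  assumes \<beta>: "\<forall>i. \<bar>\<beta> i\<bar> \<le> K" and x: "x \<in> {0..1}"
    and c: "c \<le> \<bar>\<beta> i\<bar>" "K \<le> real (Suc i) * c"
  shows "\<exists>a b. 0 \<le> a \<and> a \<le> x \<and> x \<le> b \<and> b \<le> 1 \<and> a < b \<and>
    (real (Suc i) * c - K) * (b - a) \<le> norm (combination_integral \<beta> {0..b} - combination_integral \<beta> {0..a})"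
proof -
  have K: "0 \<le> K" using \<beta>[rule_format, of 0] by simp
  obtain a b where ab: "0 \<le> a" "a \<le> x" "x \<le> b" "b \<le> 1" "d i \<le> b - a"
    and big: "real (Suc i) * (1 + (\<Sum>l<i. M l)) * (b - a) \<le> norm (I i {0..b} - I i {0..a})"
    using steep[OF x] by blast
  have "a < b" using ab d_pos[of i] by simp
  define B where "B = 1 + (\<Sum>l<i. M l)"
  have "1 \<le> B" unfolding B_def using M_nonneg by (simp add: sum_nonneg)
  define z where "z l = \<beta> l *\<^sub>R (I l {0..b} - I l {0..a})" for l
  have sz: "summable z"
    unfolding z_def scaleR_right_diff_distrib
    by (intro summable_diff summable_combination_integral[OF \<beta>]) auto
  have "combination_integral \<beta> {0..b} - combination_integral \<beta> {0..a} = (\<Sum>l. z l)"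
    unfolding combination_integral_def z_def scaleR_right_diff_distrib
    by (intro suminf_diff summable_combination_integral[OF \<beta>]) auto
  also have "\<dots> = (\<Sum>l. z (l + Suc i)) + (\<Sum>l<i. z l) + z i"
    using suminf_split_initial_segment[OF sz, of "Suc i"] by simp
  finally have eq: "combination_integral \<beta> {0..b} - combination_integral \<beta> {0..a} = \<dots>" .
  have z_small: "norm (z l) \<le> 2 * K * \<eta> l" for l
    using norm_scaled_le[OF \<beta>[rule_format], of "{0..b}" l l] norm_scaled_le[OF \<beta>[rule_format], of "{0..a}" l l]
      norm_triangle_ineq4[of "\<beta> l *\<^sub>R I l {0..b}" "\<beta> l *\<^sub>R I l {0..a}"]
    by (simp add: z_def scaleR_right_diff_distrib)
  have tail: "norm (\<Sum>l. z (l + Suc i)) \<le> K * (b - a)"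
  proof -
    have s\<eta>: "summable (\<lambda>l. \<eta> (l + Suc i))" using summable_\<eta> by (rule summable_ignore_initial_segment)
    have "norm (\<Sum>l. z (l + Suc i)) \<le> (\<Sum>l. 2 * K * \<eta> (l + Suc i))"
      using z_small by (intro norm_suminf_le summable_mult s\<eta>)
    also have "\<dots> = K * (2 * (\<Sum>l. \<eta> (l + Suc i)))" using suminf_mult[OF s\<eta>, of "2 * K"] by simp
    also have "\<dots> \<le> K * (b - a)" using tail_small[of i] ab K by (intro mult_left_mono) auto
    finally show ?thesis .
  qed
  have head: "norm (\<Sum>l<i. z l) \<le> K * (\<Sum>l<i. M l) * (b - a)"
  proof -
    have "norm (\<Sum>l<i. z l) \<le> (\<Sum>l<i. K * (M l * (b - a)))"
    proof (rule sum_norm_le)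
      fix l
      show "norm (z l) \<le> K * (M l * (b - a))"
        unfolding z_def norm_scaleR using lipschitz[of a b l] ab \<beta>[rule_format, of l] K
        by (intro mult_mono) auto
    qed
    then show ?thesis by (simp add: sum_distrib_left sum_distrib_right mult_ac)
  qed
  have "real (Suc i) * c * (B * (b - a)) \<le> norm (z i)"
  proof -
    have "real (Suc i) * c * (B * (b - a)) = c * (real (Suc i) * B * (b - a))" by simp
    also have "\<dots> \<le> \<bar>\<beta> i\<bar> * (real (Suc i) * B * (b - a))"
      using c(1) \<open>1 \<le> B\<close> \<open>a < b\<close> by (intro mult_right_mono) auto
    also have "\<dots> \<le> \<bar>\<beta> i\<bar> * norm (I i {0..b} - I i {0..a})"
      using big by (intro mult_left_mono) (auto simp: B_def)
    finally show ?thesis by (simp add: z_def)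
  qed
  moreover have "K * (b - a) + K * (\<Sum>l<i. M l) * (b - a) = K * (B * (b - a))"
    by (simp add: B_def algebra_simps)
  moreover have "norm (z i) \<le> norm (combination_integral \<beta> {0..b} - combination_integral \<beta> {0..a})
      + norm (\<Sum>l. z (l + Suc i)) + norm (\<Sum>l<i. z l)"
    unfolding eq
    using norm_triangle_ineq4[of "(\<Sum>l. z (l + Suc i)) + (\<Sum>l<i. z l) + z i" "(\<Sum>l. z (l + Suc i)) + (\<Sum>l<i. z l)"]
      norm_triangle_ineq[of "\<Sum>l. z (l + Suc i)" "\<Sum>l<i. z l"] by simp
  ultimately have "(real (Suc i) * c - K) * (B * (b - a)) \<le> norm (combination_integral \<beta> {0..b} - combination_integral \<beta> {0..a})"
    using tail head by (simp add: left_diff_distrib)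
  moreover have "(real (Suc i) * c - K) * (1 * (b - a)) \<le> (real (Suc i) * c - K) * (B * (b - a))"
    using c(2) \<open>1 \<le> B\<close> \<open>a < b\<close> by (intro mult_left_mono mult_right_mono) auto
  ultimately show ?thesis
    using ab \<open>a < b\<close> by (intro exI[of _ a] exI[of _ b]) auto
qed

text \<open>
  If both endpoints of a cell containing \<open>x\<close> had a small slope towards \<open>x\<close>, so would the whole cell. The endpoint is
  automatically close to \<open>x\<close>, because the integrals are bounded and the slope is large.
\<close>

lemma steep_increments:
  assumes \<beta>: "\<forall>i. \<bar>\<beta> i\<bar> \<le> K" and "0 < c" and large: "\<exists>\<^sub>\<infinity>i. c \<le> \<bar>\<beta> i\<bar>"
    and x: "x \<in> {0..1}" and "0 < e" and "0 < C"
  shows "\<exists>s\<in>{0..1}. s \<noteq> x \<and> \<bar>s - x\<bar> < e \<and>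
    C * \<bar>s - x\<bar> \<le> norm (combination_integral \<beta> {0..s} - combination_integral \<beta> {0..x})"
proof -
  define S where "S = K * (\<Sum>i. \<eta> i)"
  have G: "norm (combination_integral \<beta> {0..s}) \<le> S" for s
    unfolding S_def by (rule norm_combination_integral_le[OF \<beta>]) auto
  have "0 \<le> S" using G[of 0] norm_ge_zero order_trans by blast
  \<comment> \<open>With slope at least \<open>(2 * S + 1) / e\<close>, an increment of size at most \<open>2 * S\<close> takes place within distance \<open>e\<close>.\<close>
  define L where "L = max C ((2 * S + 1) / e)"
  have L: "C \<le> L" "(2 * S + 1) / e \<le> L" "0 < L" using \<open>0 < C\<close> by (auto simp: L_def)
  obtain m :: nat where "(K + L) / c \<le> real m" using real_arch_simple by blast
  moreover obtain i where "m \<le> i" "c \<le> \<bar>\<beta> i\<bar>" using large by (auto simp: INFM_nat_le)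
  ultimately have "(K + L) / c \<le> real (Suc i)" by simp
  then have iL: "K + L \<le> real (Suc i) * c" using \<open>0 < c\<close> by (simp add: pos_divide_le_eq)
  obtain a b where ab: "0 \<le> a" "a \<le> x" "x \<le> b" "b \<le> 1" "a < b"
    and "(real (Suc i) * c - K) * (b - a) \<le> norm (combination_integral \<beta> {0..b} - combination_integral \<beta> {0..a})"
    using cell_increment[OF \<beta> x \<open>c \<le> \<bar>\<beta> i\<bar>\<close>] iL L(3) by auto
  moreover have "L * (b - a) \<le> (real (Suc i) * c - K) * (b - a)"
    using iL \<open>a < b\<close> by (intro mult_right_mono) auto
  ultimately have "L * (b - x) + L * (x - a) \<le> norm (combination_integral \<beta> {0..b} - combination_integral \<beta> {0..a})"
    by (simp add: algebra_simps)
  also have "\<dots> \<le> norm (combination_integral \<beta> {0..b} - combination_integral \<beta> {0..x}) + norm (combination_integral \<beta> {0..a} - combination_integral \<beta> {0..x})"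
    using norm_triangle_ineq4[of "combination_integral \<beta> {0..b} - combination_integral \<beta> {0..x}" "combination_integral \<beta> {0..a} - combination_integral \<beta> {0..x}"]
    by simp
  finally have "\<exists>s\<in>{a, b}. s \<noteq> x \<and> L * \<bar>s - x\<bar> \<le> norm (combination_integral \<beta> {0..s} - combination_integral \<beta> {0..x})"
    using ab by (cases "a = x"; cases "b = x") (auto simp: abs_if)
  then obtain s where s: "s \<in> {a, b}" "s \<noteq> x" "L * \<bar>s - x\<bar> \<le> norm (combination_integral \<beta> {0..s} - combination_integral \<beta> {0..x})"
    by blast
  have "(2 * S + 1) / e * \<bar>s - x\<bar> \<le> L * \<bar>s - x\<bar>" using L by (intro mult_right_mono) auto
  also have "\<dots> \<le> 2 * S"
    using s(3) G[of s] G[of x] norm_triangle_ineq4[of "combination_integral \<beta> {0..s}" "combination_integral \<beta> {0..x}"] by simp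
  finally have "(2 * S + 1) * \<bar>s - x\<bar> \<le> 2 * S * e" using \<open>0 < e\<close> by (simp add: field_simps)
  also have "\<dots> < (2 * S + 1) * e" using \<open>0 < e\<close> by (simp add: algebra_simps)
  finally have "\<bar>s - x\<bar> < e" using \<open>0 \<le> S\<close> by (simp add: mult_less_cancel_left)
  moreover have "C * \<bar>s - x\<bar> \<le> norm (combination_integral \<beta> {0..s} - combination_integral \<beta> {0..x})"
    using L by (intro order_trans[OF _ s(3)] mult_right_mono) auto
  ultimately show ?thesis using s ab by (intro bexI[of _ s]) auto
qed

lemma Limsup_combination:
  assumes \<beta>: "\<forall>i. \<bar>\<beta> i\<bar> \<le> K" and c: "0 < c" "\<exists>\<^sub>\<infinity>i. c \<le> \<bar>\<beta> i\<bar>" and x: "x \<in> {0..1}"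
  shows "Limsup (at 0 within {h. x + h \<in> {0..1}})
    (\<lambda>h. ereal (norm ((pettis_primitive (combination \<beta>) (x + h) - pettis_primitive (combination \<beta>) x) /\<^sub>R h))) = \<infinity>"
proof -
  let ?q = "\<lambda>h. ereal (norm ((combination_integral \<beta> {0..x + h} - combination_integral \<beta> {0..x}) /\<^sub>R h))"
  have "\<infinity> \<le> Limsup (at 0 within {h. x + h \<in> {0..1}}) ?q"
  proof (rule Limsup_greatest)
    fix P assume "eventually P (at 0 within {h. x + h \<in> {0..1}})"
    then obtain e where e: "0 < e" "\<And>h. x + h \<in> {0..1} \<Longrightarrow> h \<noteq> 0 \<Longrightarrow> \<bar>h\<bar> < e \<Longrightarrow> P h"
      by (auto simp: eventually_at dist_real_def)
    have "ereal (real C) \<le> (SUP h\<in>Collect P. ?q h)" for C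
    proof -
      obtain s where s: "s \<in> {0..1}" "s \<noteq> x" "\<bar>s - x\<bar> < e"
        "(real C + 1) * \<bar>s - x\<bar> \<le> norm (combination_integral \<beta> {0..s} - combination_integral \<beta> {0..x})"
        using steep_increments[OF \<beta> c x e(1), of "real C + 1"] by auto
      have "P (s - x)" using s by (intro e(2)) auto
      have "real C * \<bar>s - x\<bar> \<le> (real C + 1) * \<bar>s - x\<bar>" by (intro mult_right_mono) auto
      also note s(4)
      finally have "real C \<le> norm (combination_integral \<beta> {0..s} - combination_integral \<beta> {0..x}) / \<bar>s - x\<bar>"
        using s(2) by (simp add: pos_le_divide_eq)
      then have "ereal (real C) \<le> ?q (s - x)" by (simp add: divide_inverse mult.commute abs_inverse)
      also have "\<dots> \<le> (SUP h\<in>Collect P. ?q h)" using \<open>P (s - x)\<close> by (intro SUP_upper) simp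
      finally show ?thesis .
    qed
    then have "(SUP h\<in>Collect P. ?q h) = \<infinity>" by (metis less_PInf_Ex_of_nat not_less)
    then show "\<infinity> \<le> (SUP h\<in>Collect P. ?q h)" by simp
  qed
  then show ?thesis by (simp add: pettis_primitive_combination[OF \<beta>])
qed

text \<open>
  The primitive of the zero function has no steep increments.
\<close>

lemma combination_nonzero:
  assumes \<beta>: "\<forall>i. \<bar>\<beta> i\<bar> \<le> K" and c: "0 < c" "\<exists>\<^sub>\<infinity>i. c \<le> \<bar>\<beta> i\<bar>"
  shows "combination \<beta> \<noteq> (\<lambda>t. 0)"
proof
  assume 0: "combination \<beta> = (\<lambda>t. 0)"
  have "combination_integral \<beta> {0..t} = 0" for t
    unfolding pettis_primitive_combination[OF \<beta>, symmetric] pettis_primitive_def 0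
    by (rule pettis_integral_eqI) (simp add: has_pettis_integral_def set_lebesgue_integral_def blinfun.zero_right)
  with steep_increments[OF \<beta> c, of 0 1 1] show False by (auto simp del: atLeastAtMost_singleton)
qed

end

section \<open>Almost disjoint sets of indices\<close>

text \<open>
  The integer parts of \<open>n * \<alpha>\<close> and \<open>n * \<beta>\<close> differ as soon as \<open>n * \<bar>\<alpha> - \<beta>\<bar> > 1\<close>, so the graphs of
  \<open>n \<mapsto> \<lfloor>n * \<alpha>\<rfloor>\<close> for different \<open>\<alpha>\<close> are almost disjoint; \<open>to_nat\<close> moves them to the natural numbers.
\<close>

definition branch :: "real \<Rightarrow> nat set" where
  "branch \<alpha> = range (\<lambda>n :: nat. to_nat (n, \<lfloor>real n * \<alpha>\<rfloor>))"

lemma infinite_branch: "infinite (branch \<alpha>)"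
  unfolding branch_def by (rule range_inj_infinite) (auto simp: inj_on_def)

lemma finite_branch_Int:
  assumes "\<alpha> \<noteq> \<beta>"
  shows "finite (branch \<alpha> \<inter> branch \<beta>)"
proof -
  obtain m :: nat where m: "1 < real m * \<bar>\<alpha> - \<beta>\<bar>"
    using assms reals_Archimedean3[of "\<bar>\<alpha> - \<beta>\<bar>"] by auto
  have "n < m" if "\<lfloor>real n * \<alpha>\<rfloor> = \<lfloor>real n * \<beta>\<rfloor>" for n
  proof (rule ccontr)
    assume "\<not> n < m"
    have "real m * \<bar>\<alpha> - \<beta>\<bar> \<le> real n * \<bar>\<alpha> - \<beta>\<bar>" using \<open>\<not> n < m\<close> by (intro mult_right_mono) auto
    also have "\<dots> = \<bar>real n * \<alpha> - real n * \<beta>\<bar>" by (simp add: abs_mult right_diff_distrib[symmetric])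
    also have "\<dots> < 1" using that by linarith
    finally show False using m by simp
  qed
  then have "branch \<alpha> \<inter> branch \<beta> \<subseteq> (\<lambda>n. to_nat (n, \<lfloor>real n * \<alpha>\<rfloor>)) ` {..<m}"
    by (auto simp: branch_def)
  then show ?thesis by (rule finite_subset) simp
qed

lemma finite_branch_Int_Union:
  assumes "finite T"
  shows "finite (branch \<alpha> \<inter> (\<Union>\<beta>\<in>T - {\<alpha>}. branch \<beta>))"
  unfolding Int_UN_distrib using assms by (intro finite_UN_I finite_Diff finite_branch_Int) auto

lemma abs_suminf_le_tail:
  fixes w c :: "nat \<Rightarrow> real"
  assumes c: "summable (\<lambda>k. \<bar>c k\<bar>)" and w: "\<And>k. \<bar>w k\<bar> \<le> \<bar>c k\<bar>" and 0: "\<And>k. k < m \<Longrightarrow> w k = 0"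
  shows "\<bar>\<Sum>k. w k\<bar> \<le> (\<Sum>k. \<bar>c (k + m)\<bar>)"
proof -
  have "summable w" using w by (intro summable_comparison_test'[OF c]) simp
  then have "(\<Sum>k. w k) = (\<Sum>k. w (k + m))"
    using 0 suminf_split_initial_segment[of w m] by simp
  also have "\<bar>\<dots>\<bar> \<le> (\<Sum>k. \<bar>c (k + m)\<bar>)"
    using w norm_suminf_le[of "\<lambda>k. w (k + m)" "\<lambda>k. \<bar>c (k + m)\<bar>"] summable_ignore_initial_segment[OF c, of m]
    by simp
  finally show ?thesis .
qed

lemma small_tail:
  fixes c :: "nat \<Rightarrow> real"
  assumes "summable (\<lambda>k. \<bar>c k\<bar>)" and "0 < e"
  obtains m where "(\<Sum>k. \<bar>c (k + m)\<bar>) < e"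
  using suminf_exist_split[OF \<open>0 < e\<close> assms(1)] by (auto simp: abs_less_iff)

lemma abs_l1_combination_le:
  fixes c :: "nat \<Rightarrow> real"
  assumes c: "summable (\<lambda>k. \<bar>c k\<bar>)"
  shows "\<forall>i. \<bar>\<Sum>k. c k * indicator (branch (\<alpha> k)) i\<bar> \<le> (\<Sum>k. \<bar>c k\<bar>)"
  using abs_suminf_le_tail[OF c, of _ 0] by (simp add: indicator_def)

text \<open>
  The parameters \<open>\<alpha> k\<close> may repeat, so the coefficients are first collected into \<open>\<mu> v\<close>, the total coefficient of
  the branch \<open>v\<close>. If some \<open>\<mu> v\<close> is nonzero, then \<open>\<beta>\<close> is close to \<open>\<mu> v\<close> on the branch \<open>v\<close> outside a finite set. If all of them vanish, so
  does \<open>\<beta>\<close>, since collecting the coefficients of sufficiently many terms reduces \<open>\<beta> i\<close> to an arbitrarily small tail.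
\<close>

lemma l1_combination_of_branches:
  fixes c \<alpha> :: "nat \<Rightarrow> real"
  assumes c: "summable (\<lambda>k. \<bar>c k\<bar>)"
  defines "\<beta> \<equiv> \<lambda>i. \<Sum>k. c k * indicator (branch (\<alpha> k)) i"
  shows "\<beta> = (\<lambda>i. 0) \<or> (\<exists>e>0. \<exists>\<^sub>\<infinity>i. e \<le> \<bar>\<beta> i\<bar>)"
proof -
  have sm: "summable w" if "\<And>k. \<bar>w k\<bar> \<le> \<bar>c k\<bar>" for w :: "nat \<Rightarrow> real"
    using that by (intro summable_comparison_test'[OF c]) simp
  define \<mu> where "\<mu> v = (\<Sum>k. c k * of_bool (\<alpha> k = v))" for v
  have s1: "summable (\<lambda>k. c k * indicator (branch (\<alpha> k)) i)" for i
    by (rule sm) (simp add: indicator_def)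
  have s2: "summable (\<lambda>k. c k * of_bool (\<alpha> k = v))" for v
    by (rule sm) simp
  show ?thesis
  proof (cases "\<forall>v. \<mu> v = 0")
    case True
    have "\<beta> i = 0" for i
    proof (rule ccontr)
      assume "\<beta> i \<noteq> 0"
      then obtain m where m: "(\<Sum>k. \<bar>c (k + m)\<bar>) < \<bar>\<beta> i\<bar>" using small_tail[OF c, of "\<bar>\<beta> i\<bar>"] by auto
      define W where "W = \<alpha> ` {..<m}"
      have "(\<Sum>v\<in>W. indicator (branch v) i * (c k * of_bool (\<alpha> k = v))) =
          c k * indicator (branch (\<alpha> k)) i * of_bool (\<alpha> k \<in> W)" for k
      proof -
        have "(\<Sum>v\<in>W. indicator (branch v) i * (c k * of_bool (\<alpha> k = v))) =
            (\<Sum>v\<in>W. if \<alpha> k = v then c k * indicator (branch v) i else 0)"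
          by (intro sum.cong) auto
        then show ?thesis by (simp add: W_def)
      qed
      moreover have "(\<lambda>k. \<Sum>v\<in>W. indicator (branch v) i * (c k * of_bool (\<alpha> k = v))) sums (\<Sum>v\<in>W. indicator (branch v) i * \<mu> v)"
        unfolding \<mu>_def by (intro sums_sum sums_mult summable_sums s2)
      ultimately have "(\<lambda>k. c k * indicator (branch (\<alpha> k)) i * of_bool (\<alpha> k \<in> W)) sums 0"
        using True by simp
      with summable_sums[OF s1[of i]]
      have "(\<lambda>k. c k * indicator (branch (\<alpha> k)) i - c k * indicator (branch (\<alpha> k)) i * of_bool (\<alpha> k \<in> W)) sums (\<beta> i - 0)"
        unfolding \<beta>_def by (rule sums_diff)
      moreover have "c k * indicator (branch (\<alpha> k)) i - c k * indicator (branch (\<alpha> k)) i * of_bool (\<alpha> k \<in> W) =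
          c k * indicator (branch (\<alpha> k)) i * of_bool (\<alpha> k \<notin> W)" for k
        by simp
      ultimately have "\<beta> i = (\<Sum>k. c k * indicator (branch (\<alpha> k)) i * of_bool (\<alpha> k \<notin> W))"
        by (simp add: sums_iff)
      also have "\<bar>\<dots>\<bar> \<le> (\<Sum>k. \<bar>c (k + m)\<bar>)"
        by (rule abs_suminf_le_tail[OF c]) (auto simp: W_def indicator_def)
      finally show False using m by simp
    qed
    then show ?thesis by auto
  next
    case False
    then obtain v where v: "\<mu> v \<noteq> 0" by blast
    then obtain m where m: "(\<Sum>k. \<bar>c (k + m)\<bar>) < \<bar>\<mu> v\<bar> / 2" using small_tail[OF c, of "\<bar>\<mu> v\<bar> / 2"] by auto
    define B where "B = branch v \<inter> (\<Union>w\<in>\<alpha> ` {..<m} - {v}. branch w)"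
    have "\<bar>\<mu> v\<bar> / 2 \<le> \<bar>\<beta> i\<bar>" if i: "i \<in> branch v - B" for i
    proof -
      have "\<bar>\<beta> i - \<mu> v\<bar> = \<bar>\<Sum>k. c k * indicator (branch (\<alpha> k)) i - c k * of_bool (\<alpha> k = v)\<bar>"
        unfolding \<beta>_def \<mu>_def by (simp add: suminf_diff[OF s1 s2])
      also have "\<dots> \<le> (\<Sum>k. \<bar>c (k + m)\<bar>)"
        using i by (intro abs_suminf_le_tail[OF c]) (auto simp: B_def indicator_def)
      finally show ?thesis using m by linarith
    qed
    moreover have "infinite (branch v - B)"
      using infinite_branch finite_branch_Int_Union[of "\<alpha> ` {..<m}" v] by (simp add: B_def)
    ultimately have "\<exists>\<^sub>\<infinity>i. \<bar>\<mu> v\<bar> / 2 \<le> \<bar>\<beta> i\<bar>"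
      unfolding INFM_iff_infinite by (meson infinite_super mem_Collect_eq subsetI)
    then show ?thesis using v by (intro disjI2 exI[of _ "\<bar>\<mu> v\<bar> / 2"]) simp
  qed
qed

lemma finite_combination_of_branches:
  fixes u :: "real \<Rightarrow> real"
  assumes "finite T" "v \<in> T" "u v \<noteq> 0"
  shows "\<exists>\<^sub>\<infinity>i. \<bar>u v\<bar> \<le> \<bar>\<Sum>w\<in>T. u w * indicator (branch w) i\<bar>"
proof -
  define B where "B = branch v \<inter> (\<Union>w\<in>T - {v}. branch w)"
  have "(\<Sum>w\<in>T. u w * indicator (branch w) i) = u v" if "i \<in> branch v - B" for i
  proof -
    have "(\<Sum>w\<in>T - {v}. u w * indicator (branch w) i) = 0"
      using that by (intro sum.neutral) (auto simp: B_def indicator_def)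
    then show ?thesis
      using sum.remove[OF assms(1,2), of "\<lambda>w. u w * indicator (branch w) i"] that
      by (simp del: sum_mult_indicator)
  qed
  moreover have "infinite (branch v - B)"
    using infinite_branch finite_branch_Int_Union[OF assms(1), of v] by (simp add: B_def)
  ultimately show ?thesis
    unfolding INFM_iff_infinite by (smt (verit) infinite_super mem_Collect_eq subsetI)
qed

section \<open>The family of functions\<close>

context steep_sequence
begin

definition branch_function :: "real \<Rightarrow> real \<Rightarrow> 'a" where
  "branch_function \<alpha> = combination (indicator (branch \<alpha>))"

lemma sum_branch_function:
  assumes "finite T"
  shows "(\<Sum>v\<in>T. u v *\<^sub>R branch_function v t) = combination (\<lambda>i. \<Sum>v\<in>T. u v * indicator (branch v) i) t"
  by (simp add: branch_function_def combination_finite_sum scaleR_sum_right scaleR_sum_left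
      sum.swap[of _ T])

lemma finite_sum_branch_function_nonzero:
  assumes T: "finite T" "v \<in> T" "u v \<noteq> 0"
  shows "\<exists>t. (\<Sum>v\<in>T. u v *\<^sub>R branch_function v t) \<noteq> 0"
proof -
  have "\<forall>i. \<bar>\<Sum>w\<in>T. u w * indicator (branch w) i\<bar> \<le> (\<Sum>w\<in>T. \<bar>u w\<bar>)"
    by (intro allI order_trans[OF sum_abs] sum_mono) (simp add: indicator_def)
  then have "combination (\<lambda>i. \<Sum>w\<in>T. u w * indicator (branch w) i) \<noteq> (\<lambda>t. 0)"
    using finite_combination_of_branches[of T v u] T by (intro combination_nonzero[where c="\<bar>u v\<bar>"]) auto
  then show ?thesis by (auto simp: sum_branch_function[OF T(1)] fun_eq_iff)
qed

lemma inj_branch_function: "inj branch_function"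
proof (rule injI, rule ccontr)
  fix v w assume "branch_function v = branch_function w" and "v \<noteq> w"
  then show False
    using finite_sum_branch_function_nonzero[of "{v, w}" v "\<lambda>z. if z = v then 1 else -1"] by auto
qed

lemma independent_branch_function: "fun_space.independent (range branch_function)"
proof
  assume "fun_space.dependent (range branch_function)"
  then obtain t u f where t: "finite t" "t \<subseteq> range branch_function" "f \<in> t" "u f \<noteq> 0"
    and 0: "(\<Sum>f\<in>t. (\<lambda>x. u f *\<^sub>R f x)) = 0"
    unfolding fun_space.dependent_explicit by blast
  define T where "T = branch_function -` t"
  have T: "finite T" "t = branch_function ` T"
    using t inj_branch_function by (auto simp: T_def intro: finite_vimageI)
  then obtain v where "v \<in> T" "f = branch_function v" using t by blast
  then obtain x where "(\<Sum>v\<in>T. u (branch_function v) *\<^sub>R branch_function v x) \<noteq> 0"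
    using finite_sum_branch_function_nonzero[OF T(1), of v "\<lambda>v. u (branch_function v)"] t by auto
  moreover have "(\<Sum>f\<in>t. (\<lambda>x. u f *\<^sub>R f x)) x = (\<Sum>f\<in>t. u f *\<^sub>R f x)"
    using t(1) by (induction t) auto
  moreover have "\<dots> = (\<Sum>v\<in>T. u (branch_function v) *\<^sub>R branch_function v x)"
    unfolding T(2) using inj_branch_function by (subst sum.reindex) (auto intro: inj_on_subset)
  ultimately show False by (simp add: 0)
qed

lemma branch_function_series:
  assumes c: "summable (\<lambda>k. \<bar>c k\<bar>)"
  shows "(\<lambda>k. c k *\<^sub>R branch_function (\<alpha> k) t) sums combination (\<lambda>i. \<Sum>k. c k * indicator (branch (\<alpha> k)) i) t"
proof -
  have "summable (\<lambda>k. c k * indicator (branch (\<alpha> k)) i)" for i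
    by (rule summable_comparison_test'[OF c]) (simp add: indicator_def)
  then have "(\<lambda>k. \<Sum>i | h i t \<noteq> 0. (c k * indicator (branch (\<alpha> k)) i) *\<^sub>R h i t) sums
      (\<Sum>i | h i t \<noteq> 0. (\<Sum>k. c k * indicator (branch (\<alpha> k)) i) *\<^sub>R h i t)"
    by (intro sums_sum sums_scaleR_left summable_sums)
  then show ?thesis
    by (simp add: branch_function_def combination_finite_sum scaleR_sum_right)
qed

end

theorem theorem2p2:
  assumes "\<not> (\<exists>B :: 'a::banach set. finite B \<and> span B = UNIV)"
  shows "\<exists>V :: (real \<Rightarrow> 'a) set.
    V \<subseteq> pettis_functions \<and>
    V \<approx> (UNIV :: real set) \<and>
    fun_space.independent V \<and>
    (\<forall>(c :: nat \<Rightarrow> real) (g :: nat \<Rightarrow> real \<Rightarrow> 'a).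
       summable (\<lambda>k. \<bar>c k\<bar>) \<and> (\<forall>k. g k \<in> V) \<longrightarrow>
       (\<forall>t\<in>{0..1}. summable (\<lambda>k. c k *\<^sub>R g k t)) \<and>
       (\<lambda>t. \<Sum>k. c k *\<^sub>R g k t) \<in> pettis_functions \<and>
       ((\<lambda>t. \<Sum>k. c k *\<^sub>R g k t) \<noteq> (\<lambda>t. 0) \<longrightarrow>
        (\<forall>x\<in>{0..1}.
           Limsup (at 0 within {h. x + h \<in> {0..1}})
             (\<lambda>h. ereal (norm ((pettis_primitive (\<lambda>t. \<Sum>k. c k *\<^sub>R g k t) (x + h)
                                - pettis_primitive (\<lambda>t. \<Sum>k. c k *\<^sub>R g k t) x) /\<^sub>R h)))
           = \<infinity>)))"
proof -
  obtain h :: "nat \<Rightarrow> real \<Rightarrow> 'a" and I M d \<eta> where "steep_sequence h I M d \<eta>"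
    using steep_sequence_exists[OF assms] by blast
  then interpret steep_sequence h I M d \<eta> .
  show ?thesis
  proof (intro exI conjI allI impI)
    show "range branch_function \<subseteq> pettis_functions"
      unfolding branch_function_def
      by (auto intro!: combination_pettis_function[where K=1] simp: indicator_def)
    show "range branch_function \<approx> (UNIV :: real set)"
      using inj_branch_function by (intro inj_on_image_eqpoll_self) 
    show "fun_space.independent (range branch_function)" by (rule independent_branch_function)
    fix c :: "nat \<Rightarrow> real" and g :: "nat \<Rightarrow> real \<Rightarrow> 'a"
    assume *: "summable (\<lambda>k. \<bar>c k\<bar>) \<and> (\<forall>k. g k \<in> range branch_function)"
    then have c: "summable (\<lambda>k. \<bar>c k\<bar>)" by blast
    from * have "\<forall>k. \<exists>\<alpha>. g k = branch_function \<alpha>" by blast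
    then obtain \<alpha> where g: "\<And>k. g k = branch_function (\<alpha> k)" by metis
    define \<beta> where "\<beta> i = (\<Sum>k. c k * indicator (branch (\<alpha> k)) i)" for i
    have bound: "\<forall>i. \<bar>\<beta> i\<bar> \<le> (\<Sum>k. \<bar>c k\<bar>)" unfolding \<beta>_def by (rule abs_l1_combination_le[OF c])
    have series: "(\<lambda>k. c k *\<^sub>R g k t) sums combination \<beta> t" for t
      unfolding g \<beta>_def by (rule branch_function_series[OF c])
    have eq: "(\<lambda>t. \<Sum>k. c k *\<^sub>R g k t) = combination \<beta>"
      using series by (auto simp: sums_iff)
    show "\<forall>t\<in>{0..1}. summable (\<lambda>k. c k *\<^sub>R g k t)" using series by (auto simp: sums_iff)
    show "(\<lambda>t. \<Sum>k. c k *\<^sub>R g k t) \<in> pettis_functions"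
      unfolding eq by (rule combination_pettis_function[OF bound])
    assume "(\<lambda>t. \<Sum>k. c k *\<^sub>R g k t) \<noteq> (\<lambda>t. 0)"
    then have "\<beta> \<noteq> (\<lambda>i. 0)" unfolding eq by (auto simp: combination_def)
    then obtain e where "0 < e" "\<exists>\<^sub>\<infinity>i. e \<le> \<bar>\<beta> i\<bar>"
      using l1_combination_of_branches[OF c, of \<alpha>] unfolding \<beta>_def by blast
    then show "\<forall>x\<in>{0..1}. Limsup (at 0 within {h. x + h \<in> {0..1}})
             (\<lambda>h. ereal (norm ((pettis_primitive (\<lambda>t. \<Sum>k. c k *\<^sub>R g k t) (x + h)
                                - pettis_primitive (\<lambda>t. \<Sum>k. c k *\<^sub>R g k t) x) /\<^sub>R h))) = \<infinity>"
      unfolding eq by (intro ballI Limsup_combination[OF bound])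
  qed
qed

end
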